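(* Let $n$ be a positive integer, let $1\le k\le n$, let $x=(x_1,\ldots,x_n)$ and $y=(y_1,y_2,\ldots)$ be two sets of variables, and let $\beta$ be a further variable. Let $m$ be an integer and let $\lambda=(\lambda_1,\lambda_2,\ldots,\lambda_k)$ be a partition (with $\lambda_1\ge\cdots\ge\lambda_k\ge 0$) such that $\lambda_1\le m-k$, and let $$\mu=(\underbrace{m-k,m-k,\ldots,m-k}_{n-k},\lambda_1,\lambda_2,\ldots,\lambda_k).$$ Then $$G_\mu(x|y)=\sum_{S\in\binom{[n]}{k}} G_\lambda(x_S|y)\,\frac{\prod_{i\in S}(1+\beta x_i)^{n-k}\prod_{j\in\overline{S}}[x_j|y]^m}{\prod_{i\in S}\prod_{j\in\overline{S}}(x_j-x_i)}.$$
   Context: The identity is one of rational functions in the variables $x_1,\ldots,x_n$, $y_1,y_2,\ldots$ and $\beta$. Write $[n]=\{1,\ldots,n\}$, let $\binom{[n]}{k}$ be the set of $k$-element subsets of $[n]$, and $\overline{S}=[n]\setminus S$. For $S=\{i_1<i_2<\cdots<i_k\}$ put $x_S=(x_{i_1},\ldots,x_{i_k})$. Empty products equal $1$. Let $x_i\oplus y_j=x_i+y_j+\beta x_iy_j$, and for an integer $p\ge 0$ let $[x_i|y]^p=(x_i\oplus y_1)(x_i\oplus y_2)\cdots(x_i\oplus y_p)$, with $[x_i|y]^0=1$. A partition $\lambda=(\lambda_1,\ldots,\lambda_\ell)$ is a weakly decreasing sequence of nonnegative integers, with $|\lambda|=\sum_i\lambda_i$; it is identified with its Young diagram, which has $\lambda_i$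 left-justified squares in row $i$ (trailing zeros are immaterial). The square in row $i$ and column $j$ is $\alpha=(i,j)$, and its content is $c(\alpha)=j-i$. A set-valued tableau $T$ of shape $\lambda$ assigns to each square $\alpha$ a finite nonempty set $T(\alpha)$ of positive integers such that the sets weakly increase along each row and strictly increase down each column, where $A\le B$ means $\max A\le\min B$ and $A<B$ means $\max A<\min B$. Put $|T|=\sum_{\alpha\in\lambda}|T(\alpha)|$. Let $\mathcal{T}(\lambda,n)$ be the set of set-valued tableaux of shape $\lambda$ all of whose sets are subsets of $[n]$. The factorial Grothendieck polynomial in $n$ variables $x=(x_1,\ldots,x_n)$ is $$G_\lambda(x|y)=\sum_{T\in\mathcal{T}(\lambda,n)}\beta^{|T|-|\lambda|}\prod_{\alpha\in\lambda}\prod_{t\in T(\alpha)}\left(x_t\oplus y_{t+c(\alpha)}\right).$$ $G_\lambda(x_S|y)$ denotes the same polynomial in the $k$ variables $x_S$, i.e. with $n$ replaced by $k$ and $x_t$ replaced by $x_{i_t}$ for $1\le t\le k$ (the $y$ variables are unchanged). *)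

theory Defs
  imports Complex_Main "HOL-Library.Poly_Mapping" "HOL-Computational_Algebra.Fraction_Field"
begin

datatype indet = X nat | Y nat | B

(* An arbitrary linear order on the indeterminates, needed only because the library
   derives the idom instance of the polynomial ring from an order on monomials. *)

fun indet_code :: "indet \<Rightarrow> nat" where
  "indet_code (X i) = 2 * i + 1"
| "indet_code (Y i) = 2 * i + 2"
| "indet_code B = 0"

lemma indet_code_inj: "indet_code u = indet_code v \<Longrightarrow> u = v"
  by (cases u; cases v; simp; presburger)

instantiation indet :: linorder
begin
definition "less_eq_indet u v \<longleftrightarrow> indet_code u \<le> indet_code v"
definition "less_indet u v \<longleftrightarrow> indet_code u < indet_code v"
instance
  by standard (auto simp: less_eq_indet_def less_indet_def intro: indet_code_inj)
end

(* The field of rational functions in x_i, y_i (i a natural number) and beta over the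
   domain 'a: fractions of finitely supported maps from monomials to coefficients, a
   monomial being a finitely supported map from indeterminates to exponents. *)
type_synonym 'a ratfun = "((indet \<Rightarrow>\<^sub>0 nat) \<Rightarrow>\<^sub>0 'a) fract"

definition indet_fun :: "indet \<Rightarrow> 'a::idom ratfun" where
  "indet_fun v = Fract (Poly_Mapping.single (Poly_Mapping.single v 1) 1) 1"

definition xvar :: "nat \<Rightarrow> 'a::idom ratfun" where "xvar i = indet_fun (X i)"
definition yvar :: "nat \<Rightarrow> 'a::idom ratfun" where "yvar j = indet_fun (Y j)"
definition bvar :: "'a::idom ratfun" where "bvar = indet_fun B"

definition oplus :: "'a::comm_ring_1 \<Rightarrow> 'a \<Rightarrow> 'a \<Rightarrow> 'a" where
  "oplus \<beta> a b = a + b + \<beta> * a * b"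

definition fpow :: "'a::comm_ring_1 \<Rightarrow> (nat \<Rightarrow> 'a) \<Rightarrow> 'a \<Rightarrow> nat \<Rightarrow> 'a" where
  "fpow \<beta> y a p = (\<Prod>j=1..p. oplus \<beta> a (y j))"

definition is_partition :: "nat list \<Rightarrow> bool" where
  "is_partition lam \<longleftrightarrow> sorted_wrt (\<ge>) lam"

(* Rows and columns are numbered from 1, list positions from 0. *)
definition diagram :: "nat list \<Rightarrow> (nat \<times> nat) set" where
  "diagram lam = {(i, j). 1 \<le> i \<and> i \<le> length lam \<and> 1 \<le> j \<and> j \<le> lam ! (i - 1)}"

definition content :: "nat \<times> nat \<Rightarrow> int" where
  "content \<alpha> = int (snd \<alpha>) - int (fst \<alpha>)"

(* Fillings are total functions, normalised to be empty off the diagram, so that each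
   tableau corresponds to exactly one function. *)
definition set_valued_tableau :: "nat list \<Rightarrow> (nat \<times> nat \<Rightarrow> nat set) \<Rightarrow> bool" where
  "set_valued_tableau lam T \<longleftrightarrow>
     (\<forall>\<alpha>\<in>diagram lam. finite (T \<alpha>) \<and> T \<alpha> \<noteq> {} \<and> (\<forall>t\<in>T \<alpha>. 1 \<le> t)) \<and>
     (\<forall>\<alpha>. \<alpha> \<notin> diagram lam \<longrightarrow> T \<alpha> = {}) \<and>
     (\<forall>i j j'. (i, j) \<in> diagram lam \<and> (i, j') \<in> diagram lam \<and> j < j' \<longrightarrow>
        Max (T (i, j)) \<le> Min (T (i, j'))) \<and>
     (\<forall>i i' j. (i, j) \<in> diagram lam \<and> (i', j) \<in> diagram lam \<and> i < i' \<longrightarrow>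
        Max (T (i, j)) < Min (T (i', j)))"

definition tableaux :: "nat list \<Rightarrow> nat \<Rightarrow> (nat \<times> nat \<Rightarrow> nat set) set" where
  "tableaux lam n = {T. set_valued_tableau lam T \<and> (\<forall>\<alpha>\<in>diagram lam. T \<alpha> \<subseteq> {1..n})}"

definition tableau_size :: "nat list \<Rightarrow> (nat \<times> nat \<Rightarrow> nat set) \<Rightarrow> nat" where
  "tableau_size lam T = (\<Sum>\<alpha>\<in>diagram lam. card (T \<alpha>))"

(* The variables are x 1, ..., x n and y 1, y 2, ....  The two truncations are harmless:
   tableau_size lam T is at least |lam| because all cells are nonempty, and an entry t in
   row i satisfies t >= i by column strictness, so that t + content >= 1. *)
definition grothendieck ::
    "nat list \<Rightarrow> nat \<Rightarrow> 'a::comm_ring_1 \<Rightarrow> (nat \<Rightarrow> 'a) \<Rightarrow> (nat \<Rightarrow> 'a) \<Rightarrow> 'a" where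
  "grothendieck lam n \<beta> x y =
     (\<Sum>T\<in>tableaux lam n. \<beta> ^ (tableau_size lam T - sum_list lam) *
        (\<Prod>\<alpha>\<in>diagram lam. \<Prod>t\<in>T \<alpha>. oplus \<beta> (x t) (y (nat (int t + content \<alpha>)))))"

(* For S = {i_1 < ... < i_k} and 1 <= t <= k, subvars x S t = x i_t. *)
definition subvars :: "(nat \<Rightarrow> 'a) \<Rightarrow> nat set \<Rightarrow> nat \<Rightarrow> 'a" where
  "subvars x S t = x (sorted_list_of_set S ! (t - 1))"

end

theory Submission
  imports Defs
begin

text \<open>
The identity is a Laplace expansion. The key fact, \<open>grothendieck_eq_bialternant\<close>, is the
bialternant formula: for a partition \<open>\<lambda>\<close> with \<open>n\<close> parts,
\<open>G\<^sub>\<lambda>(x|y) = det ([x\<^sub>j|y]\<^bsup>\<lambda>\<^sub>i+n-i\<^esup> (1 + \<beta> x\<^sub>j)\<^bsup>i-1\<^esup>) / (\<Prod>i<j. x\<^sub>i - x\<^sub>j)\<close>.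
In the determinant for \<open>\<mu>\<close>, the first \<open>n - k\<close> rows are those of a rectangle with \<open>n - k\<close> rows of
length \<open>m\<close>, and the last \<open>k\<close> rows are those of \<open>\<lambda>\<close>, each multiplied by \<open>(1 + \<beta> x\<^sub>j)\<^bsup>n-k\<^esup>\<close>.
Expanding along the first \<open>n - k\<close> rows gives a sum over the sets \<open>S\<close> of columns used by the last
\<open>k\<close> rows. The Vandermonde product splits accordingly and leaves the mixed denominator
\<open>\<Prod>i\<in>S. \<Prod>j\<notin>S. x\<^sub>j - x\<^sub>i\<close>, and the factor for the rectangle, a Grothendieck polynomial in as many
variables as the rectangle has rows, is the plain product of the \<open>[x\<^sub>j|y]\<^bsup>m\<^esup>\<close>.

The bialternant formula is proved by induction on the number of variables. Removing the largest
entry \<open>n + 1\<close> from a set-valued tableau leaves a tableau whose shape interlaces the original one,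
and the weight of the removed entries is a product over the rows (\<open>grothendieck_branching\<close>).
The determinant is multilinear in its rows, so the sum over interlacing shapes can be carried out
inside each row, where it telescopes (\<open>fpow_telescope\<close>). The result is exactly what remains of the
larger determinant after row operations have cleared the column of the last variable
(\<open>bialternant_row_operations\<close>, \<open>bialternant_eliminated_column\<close>).

Quotients of determinants by Vandermonde products are symmetric in the columns and are
therefore treated as functions of a finite set of field elements, defined by expansion along the
first row. In this form no signs or permutations occur, and the expansion along several rows
(\<open>bialternant_laplace\<close>) is a short induction. The arguments need distinct \<open>x\<^sub>i\<close> with
\<open>1 + \<beta> x\<^sub>i \<noteq> 0\<close>, which holds for indeterminates.
\<close>

section \<open>Quotients of alternants by the Vandermonde product\<close>

text \<open>For an enumeration \<open>a\<^sub>1, \<dots>, a\<^sub>n\<close> of a set \<open>A\<close> of \<open>n\<close> field elements this is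
\<open>det (f i a\<^sub>j) / (\<Prod>i<j. a\<^sub>i - a\<^sub>j)\<close>. Reordering the \<open>a\<^sub>j\<close> changes the determinant and the
Vandermonde product by the same sign, so the quotient depends on the set alone; the recursion is
the Laplace expansion along the first row, in which moving \<open>a\<close> to the front absorbs the sign.\<close>

fun bialternant :: "nat \<Rightarrow> (nat \<Rightarrow> 'a \<Rightarrow> 'a::field) \<Rightarrow> 'a set \<Rightarrow> 'a" where
  "bialternant 0 f A = 1"
| "bialternant (Suc n) f A =
     (\<Sum>a\<in>A. f 0 a / (\<Prod>b\<in>A - {a}. a - b) * bialternant n (\<lambda>i. f (Suc i)) (A - {a}))"

lemma bialternant_cong:
  "(\<And>i a. i < n \<Longrightarrow> a \<in> A \<Longrightarrow> f i a = g i a) \<Longrightarrow> bialternant n f A = bialternant n g A"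
proof (induction n arbitrary: f g A)
  case (Suc n)
  show ?case
    unfolding bialternant.simps
    by (intro sum.cong refl arg_cong2[where f = "(*)"] Suc.IH) (simp_all add: Suc.prems)
qed simp

text \<open>Laplace expansion along the first \<open>p\<close> rows. The columns that the last \<open>q\<close> rows use form the set
\<open>S\<close>, and the Vandermonde product of \<open>A\<close> splits into those of \<open>A - S\<close> and of \<open>S\<close> and the mixed
product in the denominator. Peeling off the first row and exchanging the choice of its column \<open>a\<close>
with the choice of \<open>S\<close> gives the induction.\<close>

lemma bialternant_laplace:
  assumes "finite A" "card A = p + q"
  shows "bialternant (p + q) f A =
    (\<Sum>S\<in>{S. S \<subseteq> A \<and> card S = q}.
       bialternant p f (A - S) * bialternant q (\<lambda>i. f (p + i)) S / (\<Prod>i\<in>S. \<Prod>j\<in>A - S. j - i))"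
  using assms
proof (induction p arbitrary: f A)
  case 0
  then have "{S. S \<subseteq> A \<and> card S = q} = {A}"
    by (auto dest: card_subset_eq)
  then show ?case by simp
next
  case (Suc p)
  define \<S> where "\<S> = {S. S \<subseteq> A \<and> card S = q}"
  define d where "d a M = (\<Prod>b\<in>M. a - b)" for a :: 'a and M
  define D where "D S M = (\<Prod>i\<in>S. \<Prod>j\<in>M. j - i)" for S M :: "'a set"
  let ?L = "\<lambda>a S. bialternant p (\<lambda>i. f (Suc i)) (A - {a} - S)"
  let ?R = "\<lambda>S. bialternant q (\<lambda>i. f (Suc p + i)) S"
  have "bialternant (Suc p + q) f A =
      (\<Sum>a\<in>A. f 0 a / d a (A - {a}) * bialternant (p + q) (\<lambda>i. f (Suc i)) (A - {a}))"
    by (simp add: d_def)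
  also have "\<dots> = (\<Sum>a\<in>A. \<Sum>S | S \<in> \<S> \<and> a \<notin> S.
      f 0 a / d a (A - {a}) * (?L a S * ?R S / D S (A - {a} - S)))"
  proof (intro sum.cong refl)
    fix a assume a: "a \<in> A"
    then have "card (A - {a}) = p + q"
      using Suc.prems by simp
    then have "bialternant (p + q) (\<lambda>i. f (Suc i)) (A - {a}) =
        (\<Sum>S\<in>{S. S \<subseteq> A - {a} \<and> card S = q}. ?L a S * ?R S / D S (A - {a} - S))"
      by (subst Suc.IH) (use Suc.prems in \<open>simp_all add: D_def\<close>)
    also have "{S. S \<subseteq> A - {a} \<and> card S = q} = {S \<in> \<S>. a \<notin> S}"
      by (auto simp: \<S>_def)
    finally show "f 0 a / d a (A - {a}) * bialternant (p + q) (\<lambda>i. f (Suc i)) (A - {a}) =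
        (\<Sum>S | S \<in> \<S> \<and> a \<notin> S. f 0 a / d a (A - {a}) * (?L a S * ?R S / D S (A - {a} - S)))"
      by (simp add: sum_distrib_left)
  qed
  also have "\<dots> = (\<Sum>S\<in>\<S>. \<Sum>a | a \<in> A \<and> a \<notin> S.
      f 0 a / d a (A - {a}) * (?L a S * ?R S / D S (A - {a} - S)))"
    by (rule sum.swap_restrict) (use Suc.prems in \<open>simp_all add: \<S>_def\<close>)
  also have "\<dots> = (\<Sum>S\<in>\<S>. bialternant (Suc p) f (A - S) * ?R S / D S (A - S))"
  proof (rule sum.cong[OF refl])
    fix S assume "S \<in> \<S>"
    then have S: "S \<subseteq> A" "finite S" "finite (A - S)"
      using Suc.prems by (auto simp: \<S>_def intro: finite_subset)
    have "(\<Sum>a | a \<in> A \<and> a \<notin> S.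
        f 0 a / d a (A - {a}) * (?L a S * ?R S / D S (A - {a} - S))) =
      (\<Sum>a\<in>A - S. f 0 a / d a (A - S - {a}) *
        bialternant p (\<lambda>i. f (Suc i)) (A - S - {a}) * (?R S / D S (A - S)))"
    proof (rule sum.cong)
      fix a assume a: "a \<in> A - S"
      have "A - {a} = (A - S - {a}) \<union> S"
        using a S by auto
      then have "d a (A - {a}) = d a (A - S - {a}) * d a S"
        unfolding d_def by (simp only:) (rule prod.union_disjoint, use S in auto)
      moreover have "D S (A - S) = d a S * D S (A - {a} - S)"
        unfolding D_def d_def prod.distrib[symmetric]
        by (rule prod.cong[OF refl], subst prod.remove[of _ a])
           (use S a in \<open>auto simp: set_diff_eq conj_commute intro!: prod.cong\<close>)
      moreover have "A - {a} - S = A - S - {a}" by auto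
      ultimately show "f 0 a / d a (A - {a}) * (?L a S * ?R S / D S (A - {a} - S)) =
          f 0 a / d a (A - S - {a}) * bialternant p (\<lambda>i. f (Suc i)) (A - S - {a}) *
            (?R S / D S (A - S))"
        by (simp add: mult_ac)
    qed auto
    also have "\<dots> = bialternant (Suc p) f (A - S) * ?R S / D S (A - S)"
      by (subst sum_distrib_right[symmetric]) (simp add: d_def)
    finally show "(\<Sum>a | a \<in> A \<and> a \<notin> S.
        f 0 a / d a (A - {a}) * (?L a S * ?R S / D S (A - {a} - S))) =
        bialternant (Suc p) f (A - S) * ?R S / D S (A - S)" .
  qed
  finally show ?case unfolding \<S>_def D_def .
qed

lemma bialternant_scale:
  assumes "finite A" "card A = n"
  shows "bialternant n (\<lambda>i a. h a * f i a) A = (\<Prod>a\<in>A. h a) * bialternant n f A"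
  using assms
proof (induction n arbitrary: f A)
  case (Suc n)
  have "h a * f 0 a / D * bialternant n (\<lambda>i a. h a * f (Suc i) a) (A - {a}) =
      prod h A * (f 0 a / D * bialternant n (\<lambda>i. f (Suc i)) (A - {a}))" if "a \<in> A" for a D
  proof -
    have "bialternant n (\<lambda>i a. h a * f (Suc i) a) (A - {a}) =
        prod h (A - {a}) * bialternant n (\<lambda>i. f (Suc i)) (A - {a})"
      using that Suc.prems by (intro Suc.IH) auto
    moreover have "prod h A = h a * prod h (A - {a})"
      using that Suc.prems by (simp add: prod.remove)
    ultimately show ?thesis by simp
  qed
  then show ?case
    unfolding bialternant.simps sum_distrib_left by (intro sum.cong refl) blast
qed simp

lemma bialternant_multilinear:
  assumes "\<And>i. i < n \<Longrightarrow> finite (C i)"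
  shows "bialternant n (\<lambda>i a. \<Sum>b\<in>C i. w i b * f i b a) A =
    (\<Sum>l\<in>{l. length l = n \<and> (\<forall>i<n. l ! i \<in> C i)}.
       (\<Prod>i<n. w i (l ! i)) * bialternant n (\<lambda>i. f i (l ! i)) A)"
  using assms
proof (induction n arbitrary: C w f A)
  case 0
  then show ?case by simp
next
  case (Suc n)
  let ?\<L> = "{l. length l = n \<and> (\<forall>i<n. l ! i \<in> C (Suc i))}"
  have lists: "{l. length l = Suc n \<and> (\<forall>i<Suc n. l ! i \<in> C i)} = (\<lambda>(b, l). b # l) ` (C 0 \<times> ?\<L>)"
    (is "?M = _")
  proof (intro set_eqI iffI)
    fix l assume "l \<in> ?M"
    then show "l \<in> (\<lambda>(b, l). b # l) ` (C 0 \<times> ?\<L>)"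
      by (cases l) (auto simp: image_iff All_less_Suc2)
  qed (auto simp: All_less_Suc2)
  have "(\<Sum>l\<in>?M. (\<Prod>i<Suc n. w i (l ! i)) * bialternant (Suc n) (\<lambda>i. f i (l ! i)) A) =
      (\<Sum>b\<in>C 0. \<Sum>l\<in>?\<L>. (w 0 b * (\<Prod>i<n. w (Suc i) (l ! i))) *
        (\<Sum>a\<in>A. f 0 b a / (\<Prod>b\<in>A - {a}. a - b) *
          bialternant n (\<lambda>i. f (Suc i) (l ! i)) (A - {a})))"
    unfolding lists
    by (subst sum.reindex)
       (auto simp: inj_on_def sum.cartesian_product prod.lessThan_Suc_shift split_def
         simp del: prod.lessThan_Suc intro!: sum.cong)
  also have "\<dots> = (\<Sum>a\<in>A. \<Sum>b\<in>C 0. \<Sum>l\<in>?\<L>. (w 0 b * (\<Prod>i<n. w (Suc i) (l ! i))) *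
        (f 0 b a / (\<Prod>b\<in>A - {a}. a - b) *
          bialternant n (\<lambda>i. f (Suc i) (l ! i)) (A - {a})))"
    unfolding sum_distrib_left
    by (rule trans[OF sum.cong[OF refl sum.swap] sum.swap])
  also have "\<dots> = (\<Sum>a\<in>A. (\<Sum>b\<in>C 0. w 0 b * f 0 b a) / (\<Prod>b\<in>A - {a}. a - b) *
      (\<Sum>l\<in>?\<L>. (\<Prod>i<n. w (Suc i) (l ! i)) *
          bialternant n (\<lambda>i. f (Suc i) (l ! i)) (A - {a})))"
    by (simp add: sum_distrib_left sum_distrib_right sum_divide_distrib mult_ac)
       (rule sum.cong[OF refl], rule sum.swap)
  also have "\<dots> = bialternant (Suc n) (\<lambda>i a. \<Sum>b\<in>C i. w i b * f i b a) A"
    using Suc.prems by (simp add: Suc.IH)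
  finally show ?case by (rule sym)
qed

lemma sum_antisymmetric:
  fixes F :: "'b \<Rightarrow> 'b \<Rightarrow> 'a::ab_group_add"
  assumes "finite A" "\<And>a b. a \<noteq> b \<Longrightarrow> F a b = - F b a"
  shows "(\<Sum>a\<in>A. \<Sum>b\<in>A - {a}. F a b) = 0"
  using assms(1)
proof (induction A)
  case (insert c A)
  have "(\<Sum>a\<in>A. \<Sum>b\<in>insert c A - {a}. F a b) = (\<Sum>a\<in>A. F a c + (\<Sum>b\<in>A - {a}. F a b))"
    using insert.hyps by (intro sum.cong refl) (auto simp: insert_Diff_if)
  also have "\<dots> = (\<Sum>a\<in>A. - F c a)"
    using insert by (subst sum.distrib) (auto intro!: sum.cong assms(2))
  finally show ?case
    using insert.hyps by (simp add: sum_negf)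
qed simp

text \<open>The columns of the two equal rows form an ordered pair, and exchanging them only changes the sign
of the factor \<open>a - b\<close>. The terms are cancelled in pairs rather than by showing that the sum equals
its own negative, so that characteristic 2 is covered.\<close>

lemma bialternant_equal_rows:
  assumes "finite A" "f 0 = f 1"
  shows "bialternant (Suc (Suc n)) f A = 0"
proof -
  define d where "d a M = (\<Prod>b\<in>M. a - b)" for a :: 'a and M
  define h where "h = (\<lambda>i. f (Suc (Suc i)))"
  define F where "F a b = f 0 a / d a (A - {a}) * (f 0 b / d b (A - {a} - {b}) *
      bialternant n h (A - {a} - {b}))" for a b
  \<comment> \<open>The terms are extended by zero outside \<open>A\<close> so that antisymmetry holds for all pairs.\<close>
  define \<Phi> where "\<Phi> a b = (if a \<in> A \<and> b \<in> A then F a b else 0)" for a b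
  have "\<Phi> a b = - \<Phi> b a" if "a \<noteq> b" for a b
  proof (cases "a \<in> A \<and> b \<in> A")
    case True
    have d: "d a (A - {a}) = (a - b) * d a (A - {a} - {b})" if "a \<in> A" "b \<in> A" "a \<noteq> b" for a b
      unfolding d_def using that \<open>finite A\<close> by (subst prod.remove[of _ b]) auto
    have s: "A - {b} - {a} = A - {a} - {b}" by auto
    have "\<Phi> a b = f 0 a * f 0 b * bialternant n h (A - {a} - {b}) /
        ((a - b) * (d a (A - {a} - {b}) * d b (A - {a} - {b})))"
      using True d[of a b] \<open>a \<noteq> b\<close> by (simp add: \<Phi>_def F_def mult_ac)
    also have "\<dots> = f 0 a * f 0 b * bialternant n h (A - {a} - {b}) /
        (- ((b - a) * (d a (A - {a} - {b}) * d b (A - {a} - {b}))))"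
      by (simp only: minus_mult_left minus_diff_eq)
    also have "\<dots> = - \<Phi> b a"
      using True d[of b a] \<open>a \<noteq> b\<close> by (simp add: \<Phi>_def F_def s mult_ac)
    finally show ?thesis .
  qed (auto simp: \<Phi>_def)
  then have "(\<Sum>a\<in>A. \<Sum>b\<in>A - {a}. \<Phi> a b) = 0"
    by (intro sum_antisymmetric assms)
  moreover have "bialternant (Suc (Suc n)) f A = (\<Sum>a\<in>A. \<Sum>b\<in>A - {a}. \<Phi> a b)"
    using assms(2) by (simp add: \<Phi>_def F_def d_def h_def sum_distrib_left)
  ultimately show ?thesis by simp
qed

text \<open>Working downwards, each row but the last is replaced by a combination with the still unchanged row
below it; every replacement multiplies the determinant by \<open>e\<close>.\<close>

lemma bialternant_row_operations:
  assumes "finite A"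
  shows "bialternant (Suc n) (\<lambda>i a. if i < n then e * f i a - c i * f (Suc i) a else f i a) A =
    e ^ n * bialternant (Suc n) f A"
  using assms
proof (induction n arbitrary: f c A)
  case (Suc n)
  let ?N = "\<lambda>i a. e * f i a - c i * f (Suc i) a"
  let ?t = "\<lambda>a. bialternant (Suc n) (\<lambda>i. f (Suc i)) (A - {a})"
  let ?d = "\<lambda>a. \<Prod>b\<in>A - {a}. a - b"
  have "bialternant (Suc (Suc n)) (\<lambda>i a. if i < Suc n then ?N i a else f i a) A =
      (\<Sum>a\<in>A. ?N 0 a / ?d a * bialternant (Suc n)
        (\<lambda>i a. if i < n then ?N (Suc i) a else f (Suc i) a) (A - {a}))"
    by (subst bialternant.simps) simp
  also have "\<dots> = (\<Sum>a\<in>A. ?N 0 a / ?d a * (e ^ n * ?t a))"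
    by (subst Suc.IH) (simp_all add: Suc.prems)
  also have "\<dots> = e ^ Suc n * (\<Sum>a\<in>A. f 0 a / ?d a * ?t a) -
      c 0 * e ^ n * (\<Sum>a\<in>A. f 1 a / ?d a * ?t a)"
    unfolding sum_distrib_left sum_subtractf[symmetric]
    by (intro sum.cong refl) (simp add: diff_divide_distrib algebra_simps)
  also have "(\<Sum>a\<in>A. f 0 a / ?d a * ?t a) = bialternant (Suc (Suc n)) f A"
    by simp
  also have "(\<Sum>a\<in>A. f 1 a / ?d a * ?t a) =
      bialternant (Suc (Suc n)) (\<lambda>i. case i of 0 \<Rightarrow> f 1 | Suc j \<Rightarrow> f (Suc j)) A"
    by simp
  also have "\<dots> = 0"
    by (rule bialternant_equal_rows) (simp_all add: Suc.prems)
  finally show ?case by simp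
qed simp

lemma bialternant_zero_column:
  assumes "finite A" "card A = n" "z \<in> A" "\<And>i. i < n \<Longrightarrow> f i z = 0"
  shows "bialternant n f A = 0"
  using assms
proof (induction n arbitrary: f A)
  case (Suc n)
  have "f 0 a / (\<Prod>b\<in>A - {a}. a - b) * bialternant n (\<lambda>i. f (Suc i)) (A - {a}) = 0"
    if "a \<in> A" for a
    using Suc.IH[of "A - {a}" "\<lambda>i. f (Suc i)"] Suc.prems that
    by (cases "a = z") auto
  then show ?case unfolding bialternant.simps by (rule sum.neutral[rule_format])
qed auto

text \<open>If only the last row has a nonzero entry in column \<open>z\<close>, that row must use this column, and what
remains is a smaller quotient.\<close>

lemma bialternant_eliminated_column:
  assumes "finite A" "card A = n" "z \<notin> A" "\<And>i. i < n \<Longrightarrow> f i z = 0"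
  shows "bialternant (Suc n) f (insert z A) = bialternant n f A * f n z / (\<Prod>a\<in>A. a - z)"
proof -
  let ?A = "insert z A"
  have sing: "{S. S \<subseteq> ?A \<and> card S = 1} = (\<lambda>s. {s}) ` ?A"
    by (auto simp: card_1_singleton_iff)
  \<comment> \<open>Only the choice \<open>s = z\<close> for the column of the last row survives: otherwise \<open>z\<close> remains a zero column.\<close>
  have "bialternant (n + 1) f ?A = (\<Sum>s\<in>?A.
      bialternant n f (?A - {s}) * bialternant 1 (\<lambda>i. f (n + i)) {s} / (\<Prod>j\<in>?A - {s}. j - s))"
    by (subst bialternant_laplace, use assms in simp, use assms in simp, unfold sing,
        subst sum.reindex) (auto simp: inj_on_def)
  also have "\<dots> = (\<Sum>s\<in>{z}.
      bialternant n f (?A - {s}) * bialternant 1 (\<lambda>i. f (n + i)) {s} / (\<Prod>j\<in>?A - {s}. j - s))"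
  proof (rule sum.mono_neutral_right)
    show "\<forall>s\<in>?A - {z}. bialternant n f (?A - {s}) * bialternant 1 (\<lambda>i. f (n + i)) {s} /
        (\<Prod>j\<in>?A - {s}. j - s) = 0"
    proof
      fix s assume "s \<in> ?A - {z}"
      then have "bialternant n f (?A - {s}) = 0"
        using assms by (intro bialternant_zero_column[where z = z]) auto
      then show "bialternant n f (?A - {s}) * bialternant 1 (\<lambda>i. f (n + i)) {s} /
        (\<Prod>j\<in>?A - {s}. j - s) = 0" by simp
    qed
  qed (use assms in auto)
  finally show ?thesis using \<open>z \<notin> A\<close> by simp
qed

section \<open>Telescoping factorial powers\<close>

lemma fpow_Suc: "fpow \<beta> y a (Suc p) = fpow \<beta> y a p * oplus \<beta> a (y (Suc p))"
  by (simp add: fpow_def)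

lemma fpow_add: "fpow \<beta> y a (m + p) = fpow \<beta> y a m * fpow \<beta> (\<lambda>j. y (m + j)) a p"
  by (induction p) (simp_all add: fpow_Suc, simp add: fpow_def)

text \<open>Put \<open>h b = fpow \<beta> y a b * (\<Prod>p=b+1..Q+1. oplus \<beta> z (y p))\<close>. Because
\<open>oplus \<beta> a u - oplus \<beta> z u = (a - z) * (1 + \<beta> * u)\<close> and
\<open>1 + \<beta> * oplus \<beta> z u = (1 + \<beta> * z) * (1 + \<beta> * u)\<close>, the term with index \<open>b > P\<close>, multiplied by
\<open>a - z\<close> and with \<open>u = y (b + 1)\<close>, is \<open>(1 + \<beta> * z) * (h (b + 1) - h b)\<close>. The lowest term lacks the factor
\<open>1 + \<beta> * oplus \<beta> z u\<close> and, as
\<open>(1 + \<beta> * z) * oplus \<beta> a u - (1 + \<beta> * a) * oplus \<beta> z u = a - z\<close>, equals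
\<open>(1 + \<beta> * z) * h (P + 1) - (1 + \<beta> * a) * h P\<close>. The sum therefore telescopes.\<close>

lemma fpow_telescope:
  assumes "P \<le> Q"
  shows "(a - z) * (\<Sum>b=P..Q. (\<Prod>p=b+2..Q+1. oplus \<beta> z (y p)) *
      (if P < b then 1 + \<beta> * oplus \<beta> z (y (b + 1)) else 1) * fpow \<beta> y a b) =
    (1 + \<beta> * z) * fpow \<beta> y a (Q + 1) -
    (1 + \<beta> * a) * (\<Prod>p=P+1..Q+1. oplus \<beta> z (y p)) * fpow \<beta> y a P"
  using assms
proof (induction Q rule: dec_induct)
  case base
  show ?case by (simp add: fpow_Suc) (simp add: oplus_def algebra_simps)
next
  case (step Q)
  let ?w = "\<lambda>b. if P < b then 1 + \<beta> * oplus \<beta> z (y (b + 1)) else 1"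
  let ?s = "\<lambda>Q. \<Sum>b=P..Q. (\<Prod>p=b+2..Q+1. oplus \<beta> z (y p)) * ?w b * fpow \<beta> y a b"
  let ?c = "oplus \<beta> z (y (Suc Q + 1))"
  have "(\<Sum>b=P..Q. (\<Prod>p=b+2..Suc Q+1. oplus \<beta> z (y p)) * ?w b * fpow \<beta> y a b) =
      ?c * ?s Q"
    unfolding sum_distrib_left by (intro sum.cong refl) (simp add: mult_ac)
  then have "?s (Suc Q) = ?c * ?s Q + ?w (Suc Q) * fpow \<beta> y a (Suc Q)"
    using step.hyps by simp
  then have "(a - z) * ?s (Suc Q) = ?c * ((a - z) * ?s Q) +
      (a - z) * (?w (Suc Q) * fpow \<beta> y a (Suc Q))"
    by (simp add: algebra_simps)
  also have "\<dots> = ?c * ((1 + \<beta> * z) * fpow \<beta> y a (Q + 1) -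
      (1 + \<beta> * a) * (\<Prod>p=P+1..Q+1. oplus \<beta> z (y p)) * fpow \<beta> y a P) +
      (a - z) * ((1 + \<beta> * ?c) * fpow \<beta> y a (Suc Q))"
    unfolding step.IH using step.hyps by simp
  also have "\<dots> = (1 + \<beta> * z) * (fpow \<beta> y a (Q + 1) * oplus \<beta> a (y (Suc Q + 1))) -
      (1 + \<beta> * a) * ((\<Prod>p=P+1..Q+1. oplus \<beta> z (y p)) * ?c) * fpow \<beta> y a P"
    by (simp add: oplus_def algebra_simps)
  finally show ?case using step.hyps by (simp add: fpow_Suc)
qed

section \<open>Set-valued tableaux\<close>

lemma diagram_Sigma: "diagram lam = Sigma {1..length lam} (\<lambda>i. {1..lam ! (i - 1)})"
  by (auto simp: diagram_def)

lemma finite_diagram [simp]: "finite (diagram lam)"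
  by (simp add: diagram_Sigma)

lemma mem_diagram_Suc: "(Suc i, j) \<in> diagram lam \<longleftrightarrow> i < length lam \<and> 1 \<le> j \<and> j \<le> lam ! i"
  by (auto simp: diagram_def)

lemma not_mem_diagram_0 [simp]: "(0, j) \<notin> diagram lam"
  by (simp add: diagram_def)

lemma prod_diagram:
  "prod f (diagram lam) = (\<Prod>i<length lam. \<Prod>j=1..lam ! i. f (Suc i, j))"
proof -
  have "prod f (diagram lam) = (\<Prod>i=1..length lam. \<Prod>j=1..lam ! (i - 1). f (i, j))"
    unfolding diagram_Sigma by (subst prod.Sigma) auto
  also have "\<dots> = (\<Prod>i<length lam. \<Prod>j=1..lam ! i. f (Suc i, j))"
    by (rule prod.reindex_bij_witness[of _ Suc "\<lambda>i. i - 1"]) auto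
  finally show ?thesis .
qed

lemma card_diagram: "card (diagram lam) = sum_list lam"
proof -
  have "card (diagram lam) = (\<Sum>i=1..length lam. lam ! (i - 1))"
    unfolding diagram_Sigma by (subst card_SigmaI) auto
  also have "\<dots> = (\<Sum>i<length lam. lam ! i)"
    by (rule sum.reindex_bij_witness[of _ Suc "\<lambda>i. i - 1"]) auto
  finally show ?thesis by (simp add: sum_list_sum_nth atLeast0LessThan)
qed

lemma partition_nth_mono:
  "is_partition lam \<Longrightarrow> i \<le> i' \<Longrightarrow> i' < length lam \<Longrightarrow> lam ! i' \<le> lam ! i"
  unfolding is_partition_def
  by (cases "i = i'") (auto dest: sorted_wrt_nth_less[where i = i and j = i'])

text \<open>The conditions on maxima and minima become conditions on single entries; since cells off the
diagram are empty, these need no reference to the diagram.\<close>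

lemma tableaux_iff:
  "T \<in> tableaux lam n \<longleftrightarrow>
    (\<forall>\<alpha>. T \<alpha> \<noteq> {} \<longleftrightarrow> \<alpha> \<in> diagram lam) \<and> (\<forall>\<alpha>. T \<alpha> \<subseteq> {1..n}) \<and>
    (\<forall>i j j' s t. j < j' \<longrightarrow> s \<in> T (i, j) \<longrightarrow> t \<in> T (i, j') \<longrightarrow> s \<le> t) \<and>
    (\<forall>i i' j s t. i < i' \<longrightarrow> s \<in> T (i, j) \<longrightarrow> t \<in> T (i', j) \<longrightarrow> s < t)" (is "_ \<longleftrightarrow> ?R")
proof
  assume "T \<in> tableaux lam n"
  note T = this[unfolded tableaux_def set_valued_tableau_def mem_Collect_eq]
  note cells = T[THEN conjunct1, THEN conjunct1, rule_format]
    and off = T[THEN conjunct1, THEN conjunct2, THEN conjunct1, rule_format]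
    and rows = T[THEN conjunct1, THEN conjunct2, THEN conjunct2, THEN conjunct1, rule_format]
    and columns = T[THEN conjunct1, THEN conjunct2, THEN conjunct2, THEN conjunct2, rule_format]
    and range = T[THEN conjunct2, rule_format]
  have D: "\<alpha> \<in> diagram lam \<longleftrightarrow> T \<alpha> \<noteq> {}" for \<alpha>
    using cells[of \<alpha>] off[of \<alpha>] by argo
  have sub: "T \<alpha> \<subseteq> {1..n}" for \<alpha>
    using range[of \<alpha>] off[of \<alpha>] by (cases "\<alpha> \<in> diagram lam") simp_all
  have fin: "finite (T \<alpha>)" for \<alpha>
    using sub by (rule finite_subset) simp
  have "s \<le> t" if "j < j'" "s \<in> T (i, j)" "t \<in> T (i, j')" for i j j' s t
  proof -
    have "(i, j) \<in> diagram lam" "(i, j') \<in> diagram lam"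
      using that by (auto simp: D)
    then have "Max (T (i, j)) \<le> Min (T (i, j'))"
      using \<open>j < j'\<close> by (intro rows conjI)
    then show ?thesis using Max_ge[OF fin that(2)] Min_le[OF fin that(3)] by linarith
  qed
  moreover have "s < t" if "i < i'" "s \<in> T (i, j)" "t \<in> T (i', j)" for i i' j s t
  proof -
    have "(i, j) \<in> diagram lam" "(i', j) \<in> diagram lam"
      using that by (auto simp: D)
    then have "Max (T (i, j)) < Min (T (i', j))"
      using \<open>i < i'\<close> by (intro columns conjI)
    then show ?thesis using Max_ge[OF fin that(2)] Min_le[OF fin that(3)] by linarith
  qed
  ultimately show ?R by (intro conjI allI impI sub D[symmetric])
next
  assume R: ?R
  note NE = R[THEN conjunct1, rule_format]
    and sub = R[THEN conjunct2, THEN conjunct1, rule_format]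
    and row = R[THEN conjunct2, THEN conjunct2, THEN conjunct1, rule_format]
    and col = R[THEN conjunct2, THEN conjunct2, THEN conjunct2, rule_format]
  have fin: "finite (T \<alpha>)" for \<alpha>
    using sub by (rule finite_subset) simp
  have ends: "Max (T \<alpha>) \<in> T \<alpha>" "Min (T \<alpha>) \<in> T \<alpha>" if "\<alpha> \<in> diagram lam" for \<alpha>
    using that fin[of \<alpha>] NE[of \<alpha>] by simp_all
  have "1 \<le> t" if "t \<in> T \<alpha>" for \<alpha> t
    using subsetD[OF sub that] by simp
  then show "T \<in> tableaux lam n"
    unfolding tableaux_def set_valued_tableau_def mem_Collect_eq
  proof (intro conjI allI ballI impI)
    fix i j j' assume "(i, j) \<in> diagram lam \<and> (i, j') \<in> diagram lam \<and> j < j'"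
    then show "Max (T (i, j)) \<le> Min (T (i, j'))"
      by (blast intro: row[OF _ ends(1) ends(2)])
  next
    fix i i' j assume "(i, j) \<in> diagram lam \<and> (i', j) \<in> diagram lam \<and> i < i'"
    then show "Max (T (i, j)) < Min (T (i', j))"
      by (blast intro: col[OF _ ends(1) ends(2)])
  next
    fix \<alpha> assume "\<alpha> \<notin> diagram lam"
    then show "T \<alpha> = {}" by (simp flip: NE)
  next
    fix \<alpha> assume "\<alpha> \<in> diagram lam"
    then show "T \<alpha> \<noteq> {}" by (simp add: NE)
    show "T \<alpha> \<subseteq> {1..n}" by (rule sub)
  qed (simp_all add: fin)
qed

lemma
  assumes "T \<in> tableaux lam n"
  shows tableaux_nonempty: "T \<alpha> \<noteq> {} \<longleftrightarrow> \<alpha> \<in> diagram lam"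
    and tableaux_range: "T \<alpha> \<subseteq> {1..n}"
    and tableaux_row: "j < j' \<Longrightarrow> s \<in> T (i, j) \<Longrightarrow> t \<in> T (i, j') \<Longrightarrow> s \<le> t"
    and tableaux_column: "i < i' \<Longrightarrow> s \<in> T (i, j) \<Longrightarrow> t \<in> T (i', j) \<Longrightarrow> s < t"
proof -
  note T = assms[unfolded tableaux_iff]
  show "T \<alpha> \<noteq> {} \<longleftrightarrow> \<alpha> \<in> diagram lam" by (rule T[THEN conjunct1, rule_format])
  show "T \<alpha> \<subseteq> {1..n}" by (rule T[THEN conjunct2, THEN conjunct1, rule_format])
  show "j < j' \<Longrightarrow> s \<in> T (i, j) \<Longrightarrow> t \<in> T (i, j') \<Longrightarrow> s \<le> t"
    by (rule T[THEN conjunct2, THEN conjunct2, THEN conjunct1, rule_format])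
  show "i < i' \<Longrightarrow> s \<in> T (i, j) \<Longrightarrow> t \<in> T (i', j) \<Longrightarrow> s < t"
    by (rule T[THEN conjunct2, THEN conjunct2, THEN conjunct2, rule_format])
qed

lemma tableauxI:
  assumes "\<And>\<alpha>. \<alpha> \<in> diagram lam \<Longrightarrow> T \<alpha> \<noteq> {}" "\<And>\<alpha> t. t \<in> T \<alpha> \<Longrightarrow> \<alpha> \<in> diagram lam"
    "\<And>\<alpha>. T \<alpha> \<subseteq> {1..n}"
    "\<And>i j j' s t. j < j' \<Longrightarrow> s \<in> T (i, j) \<Longrightarrow> t \<in> T (i, j') \<Longrightarrow> s \<le> t"
    "\<And>i i' j s t. i < i' \<Longrightarrow> s \<in> T (i, j) \<Longrightarrow> t \<in> T (i', j) \<Longrightarrow> s < t"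
  shows "T \<in> tableaux lam n"
  unfolding tableaux_iff
proof (intro conjI allI impI)
  show "T \<alpha> \<noteq> {} \<longleftrightarrow> \<alpha> \<in> diagram lam" for \<alpha>
    using assms(1)[of \<alpha>] assms(2)[of _ \<alpha>] by auto
  show "T \<alpha> \<subseteq> {1..n}" for \<alpha> by (rule assms(3))
  show "s \<le> t" if "j < j'" "s \<in> T (i, j)" "t \<in> T (i, j')" for i j j' s t
    using that by (rule assms(4))
  show "s < t" if "i < i'" "s \<in> T (i, j)" "t \<in> T (i', j)" for i i' j s t
    using that by (rule assms(5))
qed

lemma finite_tableaux: "finite (tableaux lam n)"
proof -
  have "tableaux lam n \<subseteq> {T. \<forall>\<alpha>. (\<alpha> \<in> diagram lam \<longrightarrow> T \<alpha> \<in> Pow {1..n}) \<and>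
      (\<alpha> \<notin> diagram lam \<longrightarrow> T \<alpha> = {})}"
    using tableaux_nonempty tableaux_range by (intro subsetI CollectI allI conjI impI PowI) blast+
  moreover have "finite \<dots>"
    by (intro finite_set_of_finite_funs) auto
  ultimately show ?thesis by (rule finite_subset)
qed

text \<open>The power of \<open>\<beta>\<close> in a tableau weight is distributed over the cells: a cell with \<open>c\<close> entries
contributes \<open>\<beta> ^ (c - 1)\<close>.\<close>

definition cell_weight where
  "cell_weight \<beta> x y \<alpha> s =
    \<beta> ^ (card s - 1) * (\<Prod>t\<in>s. oplus \<beta> (x t) (y (nat (int t + content \<alpha>))))"

lemma grothendieck_cells:
  "grothendieck lam n \<beta> x y = (\<Sum>T\<in>tableaux lam n. \<Prod>\<alpha>\<in>diagram lam. cell_weight \<beta> x y \<alpha> (T \<alpha>))"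
  unfolding grothendieck_def
proof (rule sum.cong[OF refl])
  fix T assume T: "T \<in> tableaux lam n"
  have "tableau_size lam T - sum_list lam = (\<Sum>\<alpha>\<in>diagram lam. card (T \<alpha>) - 1)"
    unfolding tableau_size_def card_diagram[symmetric] card_eq_sum[of "diagram lam"]
  proof (rule sum_subtractf_nat[symmetric])
    fix \<alpha> assume "\<alpha> \<in> diagram lam"
    then have "T \<alpha> \<noteq> {}" "finite (T \<alpha>)"
      using tableaux_nonempty[OF T] finite_subset[OF tableaux_range[OF T]] by auto
    then show "1 \<le> card (T \<alpha>)" by (simp add: Suc_le_eq card_gt_0_iff)
  qed
  then show "\<beta> ^ (tableau_size lam T - sum_list lam) *
      (\<Prod>\<alpha>\<in>diagram lam. \<Prod>t\<in>T \<alpha>. oplus \<beta> (x t) (y (nat (int t + content \<alpha>)))) =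
      (\<Prod>\<alpha>\<in>diagram lam. cell_weight \<beta> x y \<alpha> (T \<alpha>))"
    by (simp add: cell_weight_def prod.distrib power_sum)
qed

lemma tableaux_entry_ge_row:
  assumes "T \<in> tableaux lam n" "is_partition lam" "t \<in> T (i, j)"
  shows "i \<le> t"
  using assms(3)
proof (induction i arbitrary: t)
  case (Suc i)
  show ?case
  proof (cases i)
    case 0
    then show ?thesis using tableaux_range[OF assms(1)] Suc.prems by fastforce
  next
    case (Suc i')
    have "(Suc i, j) \<in> diagram lam"
      using tableaux_nonempty[OF assms(1)] \<open>t \<in> T (Suc i, j)\<close> by blast
    then have "(i, j) \<in> diagram lam"
      using partition_nth_mono[OF assms(2), of i' i] by (auto simp: Suc mem_diagram_Suc)
    then obtain s where "s \<in> T (i, j)"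
      using tableaux_nonempty[OF assms(1)] by blast
    then show ?thesis
      using Suc.IH[of s] tableaux_column[OF assms(1) lessI _ Suc.prems, of s] by simp
  qed
qed simp

section \<open>Removing the largest entry\<close>

text \<open>Deleting the entry \<open>Suc n\<close> from all cells of a tableau of shape \<open>lam\<close> leaves a tableau of some
shape \<open>mu\<close> with \<open>n\<close> rows. The skew shape \<open>lam - mu\<close> contains at most one cell per column, which
says that the rows of \<open>mu\<close> interlace those of \<open>lam\<close>.\<close>

definition interlacing :: "nat list \<Rightarrow> nat list set" where
  "interlacing lam = {mu. length mu = length lam - 1 \<and>
     (\<forall>i<length lam - 1. mu ! i \<in> {lam ! Suc i..lam ! i})}"

text \<open>The (0-based) rows in which the last cell of \<open>mu\<close> has no cell of \<open>lam\<close> below it. These are the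
cells of \<open>mu\<close> that may contain \<open>Suc n\<close> together with smaller entries.\<close>

definition free_rows :: "nat list \<Rightarrow> nat list \<Rightarrow> nat set" where
  "free_rows lam mu = {i. i < length mu \<and> lam ! Suc i < mu ! i}"

text \<open>The cells that contain the largest entry: those outside \<open>mu\<close>, and the last cell of \<open>mu\<close> in each
row selected by \<open>C\<close>.\<close>

definition top_cells :: "nat list \<Rightarrow> nat list \<Rightarrow> nat set \<Rightarrow> (nat \<times> nat) set" where
  "top_cells lam mu C = (diagram lam - diagram mu) \<union> (\<lambda>i. (Suc i, mu ! i)) ` C"

definition adjoin_top :: "nat \<Rightarrow> nat list \<Rightarrow> nat list \<Rightarrow> (nat \<times> nat \<Rightarrow> nat set) \<Rightarrow> nat set
    \<Rightarrow> nat \<times> nat \<Rightarrow> nat set" where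
  "adjoin_top n lam mu U C \<alpha> = U \<alpha> \<union> (if \<alpha> \<in> top_cells lam mu C then {Suc n} else {})"

text \<open>These three recover the arguments of \<open>adjoin_top\<close> from its value. In \<open>mixed_rows\<close>, the rows whose
lower shape has length 0 are excluded because they have no last cell to share.\<close>

definition lower_part :: "nat \<Rightarrow> (nat \<times> nat \<Rightarrow> nat set) \<Rightarrow> nat \<times> nat \<Rightarrow> nat set" where
  "lower_part n T \<alpha> = T \<alpha> \<inter> {1..n}"

definition lower_shape :: "nat \<Rightarrow> (nat \<times> nat \<Rightarrow> nat set) \<Rightarrow> nat list" where
  "lower_shape n T = map (\<lambda>i. card {j. lower_part n T (Suc i, j) \<noteq> {}}) [0..<n]"

definition mixed_rows :: "nat \<Rightarrow> (nat \<times> nat \<Rightarrow> nat set) \<Rightarrow> nat set" where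
  "mixed_rows n T =
    {i. i < n \<and> 0 < lower_shape n T ! i \<and> Suc n \<in> T (Suc i, lower_shape n T ! i)}"

lemma length_lower_shape [simp]: "length (lower_shape n T) = n"
  by (simp add: lower_shape_def)

lemma down_closed_eq_interval:
  fixes J :: "nat set"
  assumes "finite J" "\<And>j. j \<in> J \<Longrightarrow> 1 \<le> j" "\<And>j j'. j \<in> J \<Longrightarrow> 1 \<le> j' \<Longrightarrow> j' \<le> j \<Longrightarrow> j' \<in> J"
  shows "J = {1..card J}"
proof (cases "J = {}")
  case False
  then have max: "Max J \<in> J" "\<And>j. j \<in> J \<Longrightarrow> j \<le> Max J"
    using \<open>finite J\<close> by (simp_all add: Max_in)
  have J: "J = {1..Max J}"
  proof (intro set_eqI iffI)
    fix j assume "j \<in> J"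
    then show "j \<in> {1..Max J}" using assms(2) max(2) by simp
  next
    fix j assume "j \<in> {1..Max J}"
    then show "j \<in> J" by (intro assms(3)[OF max(1)]) simp_all
  qed
  have "card J = Max J"
    using arg_cong[OF J, of card] by (simp only: card_atLeastAtMost diff_Suc_1)
  show ?thesis
    by (subst \<open>card J = Max J\<close>) (rule J)
qed simp

lemma interlacing_partition:
  assumes "mu \<in> interlacing lam"
  shows "is_partition mu"
  unfolding is_partition_def
proof (rule sorted_wrt_iff_nth_Suc_transp[THEN iffD2])
  show "\<forall>i. Suc i < length mu \<longrightarrow> mu ! Suc i \<le> mu ! i"
  proof (intro allI impI)
    fix i assume "Suc i < length mu"
    then have "mu ! Suc i \<le> lam ! Suc i" "lam ! Suc i \<le> mu ! i"
      using assms by (auto simp: interlacing_def)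
    then show "mu ! Suc i \<le> mu ! i" by simp
  qed
qed (auto simp: transp_def)

lemma interlacing_diagram_subset:
  assumes "mu \<in> interlacing lam"
  shows "diagram mu \<subseteq> diagram lam"
proof
  fix \<alpha> assume "\<alpha> \<in> diagram mu"
  then obtain i j where \<alpha>: "\<alpha> = (Suc i, j)" "i < length mu" "1 \<le> j" "j \<le> mu ! i"
    by (cases \<alpha>; cases "fst \<alpha>") (auto simp: mem_diagram_Suc)
  then have "mu ! i \<le> lam ! i" "i < length lam"
    using assms by (auto simp: interlacing_def)
  then show "\<alpha> \<in> diagram lam"
    using \<alpha> by (simp add: mem_diagram_Suc)
qed

context
  fixes n :: nat and lam :: "nat list"
  assumes lam: "is_partition lam" "length lam = Suc n"
begin

lemma lower_part_row:
  assumes T: "T \<in> tableaux lam (Suc n)" and "i < n"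
  shows "{j. lower_part n T (Suc i, j) \<noteq> {}} = {1..lower_shape n T ! i}"
proof -
  define J where "J = {j. lower_part n T (Suc i, j) \<noteq> {}}"
  have D: "(Suc i, j) \<in> diagram lam" if "j \<in> J" for j
    using tableaux_nonempty[OF T] that by (auto simp: J_def lower_part_def)
  have fin: "finite J"
    by (rule finite_subset[of _ "{1..lam ! i}"]) (use D in \<open>auto simp: mem_diagram_Suc\<close>)
  have down: "j' \<in> J" if "j \<in> J" "1 \<le> j'" "j' \<le> j" for j j'
  proof (cases "j' = j")
    case False
    have "(Suc i, j') \<in> diagram lam"
      using D[OF \<open>j \<in> J\<close>] that by (auto simp: mem_diagram_Suc)
    then obtain s where s: "s \<in> T (Suc i, j')"
      using tableaux_nonempty[OF T] by blast
    obtain t where t: "t \<in> T (Suc i, j)" "t \<le> n"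
      using \<open>j \<in> J\<close> by (auto simp: J_def lower_part_def)
    then have "s \<le> n"
      using tableaux_row[OF T _ s t(1)] False that by simp
    then show ?thesis
      using s subsetD[OF tableaux_range[OF T] s] by (auto simp: J_def lower_part_def)
  qed (use that in simp)
  have J: "J = {1..card J}"
  proof (rule down_closed_eq_interval)
    fix j assume "j \<in> J"
    then show "1 \<le> j" using D[of j] by (simp add: mem_diagram_Suc)
  next
    fix j j' assume "j \<in> J" "1 \<le> j'" "j' \<le> j"
    then show "j' \<in> J" by (rule down)
  qed (rule fin)
  have card: "lower_shape n T ! i = card J"
    using \<open>i < n\<close> by (simp add: J_def lower_shape_def)
  have "J = {1..lower_shape n T ! i}"
    by (subst card) (rule J)
  then show ?thesis unfolding J_def .
qed

text \<open>Entries in row \<open>i\<close> are at least \<open>i\<close>, so row \<open>Suc n\<close> retains no entry and the shape is described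
by the first \<open>n\<close> rows.\<close>

lemma lower_part_support:
  assumes T: "T \<in> tableaux lam (Suc n)"
  shows "lower_part n T \<alpha> \<noteq> {} \<longleftrightarrow> \<alpha> \<in> diagram (lower_shape n T)"
proof (cases "1 \<le> fst \<alpha> \<and> fst \<alpha> \<le> n")
  case True
  then obtain i j where "\<alpha> = (Suc i, j)" "i < n"
    by (cases \<alpha>; cases "fst \<alpha>") auto
  then show ?thesis
    using lower_part_row[OF T \<open>i < n\<close>] by (auto simp: mem_diagram_Suc)
next
  case False
  have "t \<notin> lower_part n T \<alpha>" for t
  proof
    assume t: "t \<in> lower_part n T \<alpha>"
    then have "\<alpha> \<in> diagram lam" "t \<in> T \<alpha>" "t \<le> n"
      using tableaux_nonempty[OF T, of \<alpha>] by (auto simp: lower_part_def)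
    moreover have "fst \<alpha> \<le> t"
      using tableaux_entry_ge_row[OF T lam(1), of t "fst \<alpha>" "snd \<alpha>"] \<open>t \<in> T \<alpha>\<close> by simp
    ultimately show False
      using False by (auto simp: diagram_def)
  qed
  moreover have "\<alpha> \<notin> diagram (lower_shape n T)"
    using False by (auto simp: diagram_def)
  ultimately show ?thesis by blast
qed

lemma lower_part_tableau:
  assumes T: "T \<in> tableaux lam (Suc n)"
  shows "lower_part n T \<in> tableaux (lower_shape n T) n"
proof (rule tableauxI)
  fix \<alpha> t assume "t \<in> lower_part n T \<alpha>"
  then show "\<alpha> \<in> diagram (lower_shape n T)"
    by (auto simp flip: lower_part_support[OF T])
next
  fix \<alpha> assume "\<alpha> \<in> diagram (lower_shape n T)"
  then show "lower_part n T \<alpha> \<noteq> {}" by (simp only: lower_part_support[OF T])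
qed (auto simp: lower_part_def intro: tableaux_row[OF T] tableaux_column[OF T])

text \<open>A cell with a cell of \<open>lam\<close> below it has entries smaller than those below, hence at most \<open>n\<close>.\<close>

lemma lower_shape_interlacing:
  assumes T: "T \<in> tableaux lam (Suc n)"
  shows "lower_shape n T \<in> interlacing lam"
proof -
  let ?mu = "lower_shape n T"
  have "lam ! Suc i \<le> ?mu ! i \<and> ?mu ! i \<le> lam ! i" if "i < n" for i
  proof
    show "lam ! Suc i \<le> ?mu ! i"
    proof (cases "lam ! Suc i = 0")
      case False
      let ?j = "lam ! Suc i"
      have "(Suc i, ?j) \<in> diagram lam" "(Suc (Suc i), ?j) \<in> diagram lam"
        using that lam False partition_nth_mono[OF lam(1), of i "Suc i"]
        by (auto simp: mem_diagram_Suc)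
      then obtain s t where "s \<in> T (Suc i, ?j)" "t \<in> T (Suc (Suc i), ?j)"
        using tableaux_nonempty[OF T] by blast
      then have "lower_part n T (Suc i, ?j) \<noteq> {}"
        using tableaux_column[OF T lessI, of s "Suc i" ?j t] tableaux_range[OF T]
        unfolding lower_part_def by fastforce
      then show ?thesis
        using lower_part_row[OF T \<open>i < n\<close>] by auto
    qed simp
    show "?mu ! i \<le> lam ! i"
    proof (cases "?mu ! i = 0")
      case False
      then have "(Suc i, ?mu ! i) \<in> diagram ?mu"
        using that by (auto simp: mem_diagram_Suc)
      then have "lower_part n T (Suc i, ?mu ! i) \<noteq> {}"
        by (simp add: lower_part_support[OF T])
      then have "(Suc i, ?mu ! i) \<in> diagram lam"
        using tableaux_nonempty[OF T] by (auto simp: lower_part_def)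
      then show ?thesis by (simp add: mem_diagram_Suc)
    qed simp
  qed
  then show ?thesis by (simp add: interlacing_def lam)
qed

lemma mixed_rows_free:
  assumes T: "T \<in> tableaux lam (Suc n)"
  shows "mixed_rows n T \<subseteq> free_rows lam (lower_shape n T)"
proof
  let ?mu = "lower_shape n T"
  fix i assume "i \<in> mixed_rows n T"
  then have i: "i < n" "0 < ?mu ! i" "Suc n \<in> T (Suc i, ?mu ! i)"
    by (auto simp: mixed_rows_def)
  have "(Suc (Suc i), ?mu ! i) \<notin> diagram lam"
  proof
    assume "(Suc (Suc i), ?mu ! i) \<in> diagram lam"
    then obtain t where "t \<in> T (Suc (Suc i), ?mu ! i)"
      using tableaux_nonempty[OF T] by blast
    then show False
      using tableaux_column[OF T lessI i(3)] tableaux_range[OF T] by fastforce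
  qed
  then show "i \<in> free_rows lam ?mu"
    using i lam by (simp add: mem_diagram_Suc free_rows_def)
qed

lemma adjoin_top_lower_part:
  assumes T: "T \<in> tableaux lam (Suc n)"
  shows "adjoin_top n lam (lower_shape n T) (lower_part n T) (mixed_rows n T) = T"
proof
  let ?mu = "lower_shape n T"
  fix \<alpha>
  have "Suc n \<in> T \<alpha> \<longleftrightarrow> \<alpha> \<in> top_cells lam ?mu (mixed_rows n T)"
  proof
    assume top: "Suc n \<in> T \<alpha>"
    show "\<alpha> \<in> top_cells lam ?mu (mixed_rows n T)"
    proof (cases "\<alpha> \<in> diagram ?mu")
      case True
      then obtain i j where \<alpha>: "\<alpha> = (Suc i, j)" "i < n" "1 \<le> j" "j \<le> ?mu ! i"
        by (cases \<alpha>; cases "fst \<alpha>") (auto simp: mem_diagram_Suc)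
      have "(Suc i, ?mu ! i) \<in> diagram ?mu"
        using \<alpha> by (simp add: mem_diagram_Suc)
      then obtain s where "s \<in> T (Suc i, ?mu ! i)" "s \<le> n"
        using lower_part_support[OF T, of "(Suc i, ?mu ! i)"] by (auto simp: lower_part_def)
      then have "j = ?mu ! i"
        using tableaux_row[OF T, of j "?mu ! i" "Suc n" "Suc i" s] \<alpha> top
        by (cases "j < ?mu ! i") auto
      then show ?thesis
        using \<alpha> top by (auto simp: top_cells_def mixed_rows_def)
    next
      case False
      moreover have "\<alpha> \<in> diagram lam"
        using tableaux_nonempty[OF T] top by blast
      ultimately show ?thesis by (simp add: top_cells_def)
    qed
  next
    assume "\<alpha> \<in> top_cells lam ?mu (mixed_rows n T)"
    then consider "\<alpha> \<in> diagram lam" "\<alpha> \<notin> diagram ?mu"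
      | i where "i \<in> mixed_rows n T" "\<alpha> = (Suc i, ?mu ! i)"
      by (auto simp: top_cells_def)
    then show "Suc n \<in> T \<alpha>"
    proof cases
      case 1
      then obtain t where "t \<in> T \<alpha>" "T \<alpha> \<inter> {1..n} = {}"
        using tableaux_nonempty[OF T, of \<alpha>] lower_part_support[OF T, of \<alpha>]
        by (auto simp: lower_part_def)
      then have "t = Suc n"
        using tableaux_range[OF T, of \<alpha>] by fastforce
      with \<open>t \<in> T \<alpha>\<close> show ?thesis by simp
    qed (simp add: mixed_rows_def)
  qed
  moreover have "T \<alpha> \<subseteq> {1..Suc n}"
    by (rule tableaux_range[OF T])
  ultimately show "adjoin_top n lam ?mu (lower_part n T) (mixed_rows n T) \<alpha> = T \<alpha>"
    by (auto simp: adjoin_top_def lower_part_def le_Suc_eq split: if_splits)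
qed

context
  fixes mu U C
  assumes mu: "mu \<in> interlacing lam" and U: "U \<in> tableaux mu n" and C: "C \<subseteq> free_rows lam mu"
begin

lemma length_mu: "length mu = n"
  using mu lam by (simp add: interlacing_def)

text \<open>A cell receiving the largest entry has only such cells to its right and no cell below it; this is
what keeps rows weakly and columns strictly increasing.\<close>

lemma top_cells_cases:
  assumes "(i, j) \<in> top_cells lam mu C"
  shows "(i, j) \<in> diagram lam" "j < j' \<Longrightarrow> (i, j') \<notin> diagram mu"
    "i < i' \<Longrightarrow> (i', j) \<notin> diagram lam"
proof -
  consider (skew) "(i, j) \<in> diagram lam" "(i, j) \<notin> diagram mu"
    | (mixed) r where "r \<in> C" "i = Suc r" "j = mu ! r"
    using assms by (auto simp: top_cells_def)
  then have "(i, j) \<in> diagram lam \<and> (j < j' \<longrightarrow> (i, j') \<notin> diagram mu) \<and>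
    (i < i' \<longrightarrow> (i', j) \<notin> diagram lam)"
  proof cases
    case skew
    then obtain r where r: "i = Suc r" "r \<le> n" "1 \<le> j" "j \<le> lam ! r"
      using lam by (cases i) (auto simp: mem_diagram_Suc)
    have "(i', j) \<notin> diagram lam" if "i < i'"
    proof
      assume "(i', j) \<in> diagram lam"
      then obtain r' where r': "i' = Suc r'" "r' \<le> n" "j \<le> lam ! r'"
        using lam by (cases i') (auto simp: mem_diagram_Suc)
      then have "r < n" "lam ! r' \<le> lam ! Suc r"
        using that r lam by (auto intro!: partition_nth_mono)
      then have "lam ! Suc r \<le> mu ! r"
        using mu lam by (simp add: interlacing_def)
      then have "(i, j) \<in> diagram mu"
        using \<open>r < n\<close> r r' \<open>lam ! r' \<le> lam ! Suc r\<close> length_mu by (simp add: mem_diagram_Suc)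
      with skew show False by simp
    qed
    then show ?thesis using skew r by (auto simp: mem_diagram_Suc)
  next
    case mixed
    then have r: "r < n" "lam ! Suc r < mu ! r" "mu ! r \<le> lam ! r"
      using C mu lam length_mu by (auto simp: free_rows_def interlacing_def)
    have "(i', j) \<notin> diagram lam" if "i < i'"
    proof
      assume "(i', j) \<in> diagram lam"
      then obtain r' where r': "i' = Suc r'" "r' \<le> n" "j \<le> lam ! r'"
        using lam by (cases i') (auto simp: mem_diagram_Suc)
      then have "lam ! r' \<le> lam ! Suc r"
        using that mixed lam by (auto intro!: partition_nth_mono)
      then show False using r r' mixed by simp
    qed
    then show ?thesis using r mixed lam by (auto simp: mem_diagram_Suc)
  qed
  then show "(i, j) \<in> diagram lam" "j < j' \<Longrightarrow> (i, j') \<notin> diagram mu"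
    "i < i' \<Longrightarrow> (i', j) \<notin> diagram lam" by auto
qed

lemma adjoin_top_tableau: "adjoin_top n lam mu U C \<in> tableaux lam (Suc n)"
proof -
  let ?T = "adjoin_top n lam mu U C"
  have mem: "t \<in> ?T \<alpha> \<longleftrightarrow> t \<in> U \<alpha> \<or> (t = Suc n \<and> \<alpha> \<in> top_cells lam mu C)" for t \<alpha>
    by (auto simp: adjoin_top_def)
  have U_le: "t \<le> n" "1 \<le> t" if "t \<in> U \<alpha>" for t \<alpha>
    using tableaux_range[OF U] that by fastforce+
  have U_D: "\<alpha> \<in> diagram mu" if "t \<in> U \<alpha>" for t \<alpha>
    using tableaux_nonempty[OF U] that by blast
  have T_D: "\<alpha> \<in> diagram lam" if "t \<in> ?T \<alpha>" for t \<alpha>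
    using that U_D interlacing_diagram_subset[OF mu] top_cells_cases(1) by (cases \<alpha>) (auto simp: mem)
  show ?thesis
  proof (rule tableauxI)
    fix \<alpha> assume "\<alpha> \<in> diagram lam"
    then show "?T \<alpha> \<noteq> {}"
      using tableaux_nonempty[OF U, of \<alpha>] by (auto simp: adjoin_top_def top_cells_def)
  next
    fix \<alpha>
    show "?T \<alpha> \<subseteq> {1..Suc n}"
    proof
      fix t assume "t \<in> ?T \<alpha>"
      then show "t \<in> {1..Suc n}" using U_le[of t \<alpha>] by (auto simp: mem)
    qed
  next
    fix i j j' s t assume *: "j < j'" "s \<in> ?T (i, j)" "t \<in> ?T (i, j')"
    show "s \<le> t"
    proof (cases "t \<in> U (i, j')")
      case True
      then have "(i, j) \<notin> top_cells lam mu C"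
        using top_cells_cases(2)[OF _ \<open>j < j'\<close>] U_D by blast
      then show ?thesis
        using * True by (auto simp: mem intro: tableaux_row[OF U])
    next
      case False
      then show ?thesis
        using * U_le(1)[of s "(i, j)"] by (auto simp: mem)
    qed
  next
    fix i i' j s t assume *: "i < i'" "s \<in> ?T (i, j)" "t \<in> ?T (i', j)"
    have "(i, j) \<notin> top_cells lam mu C"
      using top_cells_cases(3)[OF _ \<open>i < i'\<close>] T_D[OF *(3)] by blast
    then have "s \<in> U (i, j)" using * by (simp add: mem)
    then show "s < t"
      using * U_le(1)[of s "(i, j)"] by (auto simp: mem intro: tableaux_column[OF U])
  qed (rule T_D)
qed

lemma lower_part_adjoin_top: "lower_part n (adjoin_top n lam mu U C) = U"
proof
  fix \<alpha>
  show "lower_part n (adjoin_top n lam mu U C) \<alpha> = U \<alpha>"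
    using tableaux_range[OF U, of \<alpha>] by (auto simp: lower_part_def adjoin_top_def)
qed

lemma lower_shape_adjoin_top: "lower_shape n (adjoin_top n lam mu U C) = mu"
proof (rule nth_equalityI)
  fix i assume "i < length (lower_shape n (adjoin_top n lam mu U C))"
  then have "i < n" by simp
  then have "{j. U (Suc i, j) \<noteq> {}} = {j. 1 \<le> j \<and> j \<le> mu ! i}"
    by (simp only: tableaux_nonempty[OF U] mem_diagram_Suc length_mu simp_thms)
  also have "\<dots> = {1..mu ! i}" by auto
  finally have "card {j. U (Suc i, j) \<noteq> {}} = mu ! i" by (simp only: card_atLeastAtMost diff_Suc_1)
  then show "lower_shape n (adjoin_top n lam mu U C) ! i = mu ! i"
    using \<open>i < n\<close> by (simp only: lower_shape_def lower_part_adjoin_top) simp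
qed (simp add: length_mu)

lemma mixed_rows_adjoin_top: "mixed_rows n (adjoin_top n lam mu U C) = C"
proof (rule set_eqI)
  fix i
  have "Suc n \<notin> U \<alpha>" for \<alpha> using tableaux_range[OF U, of \<alpha>] by auto
  moreover have "i < n" "0 < mu ! i" if "i \<in> C"
    using that C length_mu by (auto simp: free_rows_def)
  moreover have "(Suc i, mu ! i) \<in> diagram mu" if "i < n" "0 < mu ! i"
    using that length_mu by (simp add: mem_diagram_Suc)
  ultimately show "i \<in> mixed_rows n (adjoin_top n lam mu U C) \<longleftrightarrow> i \<in> C"
    by (auto simp: mixed_rows_def lower_shape_adjoin_top adjoin_top_def top_cells_def)
qed

text \<open>Putting \<open>Suc n\<close> into an occupied cell costs one more factor \<open>\<beta>\<close>; in an empty cell it costs none.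
The bottom row of \<open>lam\<close> consists of cells \<open>{Suc n}\<close> only, whose \<open>y\<close> indices are \<open>1, 2, \<dots>\<close>, and
gives the factorial power.\<close>

lemma prod_cell_weight_adjoin_top:
  fixes x y :: "nat \<Rightarrow> 'a::comm_ring_1"
  shows "(\<Prod>\<alpha>\<in>diagram lam. cell_weight \<beta> x y \<alpha> (adjoin_top n lam mu U C \<alpha>)) =
    (\<Prod>\<alpha>\<in>diagram mu. cell_weight \<beta> x y \<alpha> (U \<alpha>)) *
    (\<Prod>i\<in>C. \<beta> * oplus \<beta> (x (Suc n)) (y (n + mu ! i - i))) *
    ((\<Prod>i<n. \<Prod>j=mu ! i + 1..lam ! i. oplus \<beta> (x (Suc n)) (y (n + j - i))) *
      fpow \<beta> y (x (Suc n)) (lam ! n))"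
proof -
  let ?z = "x (Suc n)" and ?T = "adjoin_top n lam mu U C"
  let ?E = "(\<lambda>i. (Suc i, mu ! i)) ` C"
  define v where "v = (\<lambda>\<alpha>. oplus \<beta> ?z (y (nat (int (Suc n) + content \<alpha>))))"
  have v: "v (Suc i, j) = oplus \<beta> ?z (y (n + j - i))" if "i \<le> n" for i j
  proof -
    have "nat (int (Suc n) + content (Suc i, j)) = n + j - i"
      using that by (simp add: content_def)
    then show ?thesis by (simp add: v_def)
  qed
  have finC: "finite C" "\<And>i. i \<in> C \<Longrightarrow> i < n"
    using C length_mu by (auto simp: free_rows_def intro: finite_subset[of _ "{..<n}"])
  have E: "?E \<subseteq> diagram mu"
    using C by (auto simp: free_rows_def mem_diagram_Suc)
  have "(\<Prod>\<alpha>\<in>diagram lam. cell_weight \<beta> x y \<alpha> (?T \<alpha>)) =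
      (\<Prod>\<alpha>\<in>diagram mu. cell_weight \<beta> x y \<alpha> (?T \<alpha>)) *
      (\<Prod>\<alpha>\<in>diagram lam - diagram mu. cell_weight \<beta> x y \<alpha> (?T \<alpha>))"
    using interlacing_diagram_subset[OF mu] by (simp add: prod.subset_diff mult.commute)
  also have "(\<Prod>\<alpha>\<in>diagram mu. cell_weight \<beta> x y \<alpha> (?T \<alpha>)) =
      (\<Prod>\<alpha>\<in>diagram mu. cell_weight \<beta> x y \<alpha> (U \<alpha>) * (if \<alpha> \<in> ?E then \<beta> * v \<alpha> else 1))"
  proof (rule prod.cong[OF refl])
    fix \<alpha> assume \<alpha>: "\<alpha> \<in> diagram mu"
    show "cell_weight \<beta> x y \<alpha> (?T \<alpha>) =
        cell_weight \<beta> x y \<alpha> (U \<alpha>) * (if \<alpha> \<in> ?E then \<beta> * v \<alpha> else 1)"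
    proof (cases "\<alpha> \<in> ?E")
      case True
      have "finite (U \<alpha>)" "U \<alpha> \<noteq> {}" "Suc n \<notin> U \<alpha>"
        using tableaux_range[OF U, of \<alpha>] tableaux_nonempty[OF U, of \<alpha>] \<alpha>
        by (auto intro: finite_subset)
      moreover have "?T \<alpha> = insert (Suc n) (U \<alpha>)"
        using True by (auto simp: adjoin_top_def top_cells_def)
      moreover have "\<beta> ^ card (U \<alpha>) = \<beta> * \<beta> ^ (card (U \<alpha>) - 1)"
        using calculation by (cases "card (U \<alpha>)") auto
      ultimately show ?thesis
        using True by (simp add: cell_weight_def v_def mult_ac)
    next
      case False
      then have "?T \<alpha> = U \<alpha>" using \<alpha> by (auto simp: adjoin_top_def top_cells_def)
      then show ?thesis using False by auto
    qed
  qed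
  also have "\<dots> = (\<Prod>\<alpha>\<in>diagram mu. cell_weight \<beta> x y \<alpha> (U \<alpha>)) *
      (\<Prod>\<alpha>\<in>diagram mu. if \<alpha> \<in> ?E then \<beta> * v \<alpha> else 1)"
    by (rule prod.distrib)
  also have "(\<Prod>\<alpha>\<in>diagram mu. if \<alpha> \<in> ?E then \<beta> * v \<alpha> else 1) = (\<Prod>\<alpha>\<in>?E. \<beta> * v \<alpha>)"
    using E by (subst prod.inter_restrict[symmetric]) (auto simp: Int_absorb1)
  also have "\<dots> = (\<Prod>i\<in>C. \<beta> * oplus \<beta> ?z (y (n + mu ! i - i)))"
    by (subst prod.reindex) (auto simp: inj_on_def v dest!: finC(2) intro!: prod.cong)
  also have "(\<Prod>\<alpha>\<in>diagram lam - diagram mu. cell_weight \<beta> x y \<alpha> (?T \<alpha>)) =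
      (\<Prod>\<alpha>\<in>diagram lam - diagram mu. v \<alpha>)"
  proof (rule prod.cong[OF refl])
    fix \<alpha> assume \<alpha>: "\<alpha> \<in> diagram lam - diagram mu"
    then have "?T \<alpha> = {Suc n}"
      using tableaux_nonempty[OF U, of \<alpha>] by (auto simp: adjoin_top_def top_cells_def)
    then show "cell_weight \<beta> x y \<alpha> (?T \<alpha>) = v \<alpha>"
      by (simp add: cell_weight_def v_def)
  qed
  also have "\<dots> = (\<Prod>\<alpha>\<in>diagram lam. if \<alpha> \<in> diagram mu then 1 else v \<alpha>)"
    by (rule prod.mono_neutral_cong_left) auto
  also have "\<dots> = (\<Prod>i<n. \<Prod>j=1..lam ! i. if (Suc i, j) \<in> diagram mu then 1 else v (Suc i, j)) *
      (\<Prod>j=1..lam ! n. if (Suc n, j) \<in> diagram mu then 1 else v (Suc n, j))"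
    unfolding prod_diagram by (simp add: lam)
  also have "(\<Prod>i<n. \<Prod>j=1..lam ! i. if (Suc i, j) \<in> diagram mu then 1 else v (Suc i, j)) =
      (\<Prod>i<n. \<Prod>j=mu ! i + 1..lam ! i. oplus \<beta> ?z (y (n + j - i)))"
    by (intro prod.cong refl prod.mono_neutral_cong_right)
       (auto simp: mem_diagram_Suc length_mu v)
  also have "(\<Prod>j=1..lam ! n. if (Suc n, j) \<in> diagram mu then 1 else v (Suc n, j)) =
      fpow \<beta> y ?z (lam ! n)"
    unfolding fpow_def by (intro prod.cong refl) (simp add: mem_diagram_Suc length_mu v)
  finally show ?thesis .
qed

end

text \<open>Tableaux of shape \<open>lam\<close> correspond to triples of an interlacing shape \<open>mu\<close>, a tableau of shape
\<open>mu\<close> with entries up to \<open>n\<close> and a set \<open>C\<close> of free rows. Summing over \<open>C\<close> turns each free row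
into a factor \<open>1 + \<beta> * oplus \<beta> z u\<close>, so the total weight is a product over the rows whose factor
for row \<open>i\<close> depends on \<open>mu\<close> only through \<open>mu ! i\<close>.\<close>

lemma grothendieck_branching:
  fixes x y :: "nat \<Rightarrow> 'a::comm_ring_1"
  defines "z \<equiv> x (Suc n)"
  shows "grothendieck lam (Suc n) \<beta> x y = fpow \<beta> y z (lam ! n) *
    (\<Sum>mu\<in>interlacing lam. (\<Prod>i<n.
        (\<Prod>j=mu ! i + 1..lam ! i. oplus \<beta> z (y (n + j - i))) *
        (if lam ! Suc i < mu ! i then 1 + \<beta> * oplus \<beta> z (y (n + mu ! i - i)) else 1)) *
      grothendieck mu n \<beta> x y)"
proof -
  let ?S = "Sigma (interlacing lam) (\<lambda>mu. tableaux mu n \<times> Pow (free_rows lam mu))"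
  let ?w = "\<lambda>T. \<Prod>\<alpha>\<in>diagram lam. cell_weight \<beta> x y \<alpha> (T \<alpha>)"
  define u where "u mu i = \<beta> * oplus \<beta> z (y (n + mu ! i - i))" for mu i
  define h where "h mu = (\<Prod>i<n. \<Prod>j=mu ! i + 1..lam ! i. oplus \<beta> z (y (n + j - i)))" for mu
  let ?g = "fpow \<beta> y z (lam ! n)"
  have len: "length mu = n" if "mu \<in> interlacing lam" for mu
    using that lam by (simp add: interlacing_def)
  have "interlacing lam \<subseteq> {mu. set mu \<subseteq> {..lam ! 0} \<and> length mu = n}"
  proof
    fix mu assume mu: "mu \<in> interlacing lam"
    have "mu ! i \<le> lam ! 0" if "i < n" for i
      using mu that lam partition_nth_mono[OF lam(1), of 0 i]
      by (auto simp: interlacing_def intro: order_trans)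
    then show "mu \<in> {mu. set mu \<subseteq> {..lam ! 0} \<and> length mu = n}"
      using len[OF mu] by (auto simp: in_set_conv_nth)
  qed
  then have fin: "finite (interlacing lam)"
    by (rule finite_subset) (simp add: finite_lists_length_eq)
  have finfree: "finite (free_rows lam mu)" for mu
    by (simp add: free_rows_def)
  have "grothendieck lam (Suc n) \<beta> x y = (\<Sum>T\<in>tableaux lam (Suc n). ?w T)"
    by (rule grothendieck_cells)
  also have "\<dots> = (\<Sum>(mu, U, C)\<in>?S. ?w (adjoin_top n lam mu U C))"
    by (rule sum.reindex_bij_witness[where
          i = "\<lambda>(mu, U, C). adjoin_top n lam mu U C" and
          j = "\<lambda>T. (lower_shape n T, lower_part n T, mixed_rows n T)"])
       (auto simp: adjoin_top_lower_part lower_shape_interlacing lower_part_tableau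
          adjoin_top_tableau lower_part_adjoin_top lower_shape_adjoin_top mixed_rows_adjoin_top
          dest: subsetD[OF mixed_rows_free])
  also have "\<dots> = (\<Sum>mu\<in>interlacing lam. \<Sum>(U, C)\<in>tableaux mu n \<times> Pow (free_rows lam mu).
      ?w (adjoin_top n lam mu U C))"
    by (rule sum.Sigma[symmetric]) (simp_all add: fin finfree finite_tableaux)
  also have "\<dots> = (\<Sum>mu\<in>interlacing lam. \<Sum>U\<in>tableaux mu n. \<Sum>C\<in>Pow (free_rows lam mu).
      ?w (adjoin_top n lam mu U C))"
    by (simp only: sum.cartesian_product)
  also have "\<dots> = (\<Sum>mu\<in>interlacing lam. \<Sum>U\<in>tableaux mu n. \<Sum>C\<in>Pow (free_rows lam mu).
      (\<Prod>\<alpha>\<in>diagram mu. cell_weight \<beta> x y \<alpha> (U \<alpha>)) * (\<Prod>i\<in>C. u mu i) * (h mu * ?g))"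
    by (intro sum.cong refl)
       (simp add: prod_cell_weight_adjoin_top u_def h_def z_def)
  also have "\<dots> = (\<Sum>mu\<in>interlacing lam. grothendieck mu n \<beta> x y *
      (\<Sum>C\<in>Pow (free_rows lam mu). \<Prod>i\<in>C. u mu i) * (h mu * ?g))"
    unfolding grothendieck_cells sum_product unfolding sum_distrib_right ..
  also have "\<dots> = (\<Sum>mu\<in>interlacing lam. ?g * ((h mu *
      (\<Prod>i<n. if lam ! Suc i < mu ! i then 1 + u mu i else 1)) * grothendieck mu n \<beta> x y))"
  proof (rule sum.cong[OF refl])
    fix mu assume "mu \<in> interlacing lam"
    have "(\<Sum>C\<in>Pow (free_rows lam mu). \<Prod>i\<in>C. u mu i) = (\<Prod>i\<in>free_rows lam mu. u mu i + 1)"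
      by (subst prod_add) (simp_all add: finfree)
    also have "\<dots> = (\<Prod>i<n. if lam ! Suc i < mu ! i then 1 + u mu i else 1)"
      by (rule prod.mono_neutral_cong_left)
         (auto simp: free_rows_def len[OF \<open>mu \<in> interlacing lam\<close>] add.commute)
    finally show "grothendieck mu n \<beta> x y *
        (\<Sum>C\<in>Pow (free_rows lam mu). \<Prod>i\<in>C. u mu i) * (h mu * ?g) = ?g * ((h mu *
        (\<Prod>i<n. if lam ! Suc i < mu ! i then 1 + u mu i else 1)) * grothendieck mu n \<beta> x y)"
      by (simp add: mult_ac)
  qed
  also have "\<dots> = ?g * (\<Sum>mu\<in>interlacing lam. (\<Prod>i<n.
        (\<Prod>j=mu ! i + 1..lam ! i. oplus \<beta> z (y (n + j - i))) *
        (if lam ! Suc i < mu ! i then 1 + \<beta> * oplus \<beta> z (y (n + mu ! i - i)) else 1)) *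
      grothendieck mu n \<beta> x y)"
    unfolding h_def u_def by (simp add: sum_distrib_left prod.distrib)
  finally show ?thesis .
qed

end

section \<open>The bialternant formula\<close>

definition bialternant_row ::
    "'a::comm_ring_1 \<Rightarrow> (nat \<Rightarrow> 'a) \<Rightarrow> nat list \<Rightarrow> nat \<Rightarrow> 'a \<Rightarrow> 'a" where
  "bialternant_row \<beta> y lam i a =
     fpow \<beta> y a (lam ! i + (length lam - Suc i)) * (1 + \<beta> * a) ^ i"

lemma grothendieck_empty_diagram:
  assumes "diagram lam = {}"
  shows "grothendieck lam n \<beta> x y = 1"
proof -
  have "tableaux lam n = {\<lambda>_. {}}"
  proof (intro set_eqI iffI)
    fix T assume "T \<in> tableaux lam n"
    then have "T \<alpha> = {}" for \<alpha>
      using tableaux_nonempty[of T lam n \<alpha>] assms by simp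
    then show "T \<in> {\<lambda>_. {}}" by auto
  next
    fix T :: "nat \<times> nat \<Rightarrow> nat set" assume "T \<in> {\<lambda>_. {}}"
    then show "T \<in> tableaux lam n" by (intro tableauxI) (simp_all add: assms)
  qed
  then show ?thesis by (simp add: grothendieck_cells assms)
qed

text \<open>The telescoping sum in the indices of the branching rule: the value \<open>b\<close> of \<open>mu ! i\<close> corresponds
to the exponent \<open>b + (n - Suc i)\<close>.\<close>

lemma skew_row_sum:
  fixes \<beta> a z :: "'a::comm_ring_1"
  assumes "i < n" "l' \<le> l"
  shows "(a - z) * (\<Sum>b=l'..l. ((\<Prod>j=b+1..l. oplus \<beta> z (y (n + j - i))) *
        (if l' < b then 1 + \<beta> * oplus \<beta> z (y (n + b - i)) else 1)) *
        fpow \<beta> y a (b + (n - Suc i))) =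
    (1 + \<beta> * z) * fpow \<beta> y a (l + (n - i)) -
    (1 + \<beta> * a) * (\<Prod>p=l' + (n - i)..l + (n - i). oplus \<beta> z (y p)) *
      fpow \<beta> y a (l' + (n - Suc i))"
proof -
  define d where "d = n - Suc i"
  have n: "n - i = Suc d" "n + j - i = j + Suc d" for j
    using assms by (auto simp: d_def)
  have "(\<Prod>j=b+1..l. oplus \<beta> z (y (n + j - i))) = (\<Prod>p=(b+d)+2..(l+d)+1. oplus \<beta> z (y p))" for b
    using prod.shift_bounds_cl_nat_ivl[of "\<lambda>p. oplus \<beta> z (y p)" "b + 1" "Suc d" l]
    by (simp add: n)
  then have "(\<Sum>b=l'..l. ((\<Prod>j=b+1..l. oplus \<beta> z (y (n + j - i))) *
        (if l' < b then 1 + \<beta> * oplus \<beta> z (y (n + b - i)) else 1)) *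
        fpow \<beta> y a (b + (n - Suc i))) =
      (\<Sum>b=l'..l. ((\<Prod>p=(b+d)+2..(l+d)+1. oplus \<beta> z (y p)) *
        (if l' + d < b + d then 1 + \<beta> * oplus \<beta> z (y ((b + d) + 1)) else 1)) *
        fpow \<beta> y a (b + d))"
    by (simp add: n d_def[symmetric] cong: if_cong)
  also have "\<dots> = (\<Sum>b=l'+d..l+d. (\<Prod>p=b+2..(l+d)+1. oplus \<beta> z (y p)) *
      (if l' + d < b then 1 + \<beta> * oplus \<beta> z (y (b + 1)) else 1) * fpow \<beta> y a b)"
    by (rule sum.shift_bounds_cl_nat_ivl[symmetric])
  finally show ?thesis
    using fpow_telescope[of "l' + d" "l + d" a z \<beta> y] assms
    by (simp add: n d_def[symmetric])
qed

text \<open>Induction on the number of variables, with \<open>z\<close> the last one. On the tableau side, the branching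
rule and multilinearity in the rows turn the sum over \<open>mu\<close> into a single quotient whose row \<open>i\<close> is
the sum over the possible values of \<open>mu ! i\<close>. After multiplication by \<open>a - z\<close> this row is a
combination of rows \<open>i\<close> and \<open>Suc i\<close> of the alternant for \<open>lam\<close>, by telescoping. On the other side
the same combinations clear the column of \<open>z\<close> except in the last row, so both sides agree up to
the factor \<open>(1 + \<beta> * z) ^ n\<close>, which can be cancelled.\<close>

theorem grothendieck_eq_bialternant:
  fixes x y :: "nat \<Rightarrow> 'a::field"
  assumes "is_partition lam" "length lam = n" "inj_on x {1..n}"
    and "\<And>i. i \<in> {1..n} \<Longrightarrow> 1 + \<beta> * x i \<noteq> 0"
  shows "grothendieck lam n \<beta> x y = bialternant n (bialternant_row \<beta> y lam) (x ` {1..n})"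
  using assms
proof (induction n arbitrary: lam)
  case 0
  then show ?case by (simp add: grothendieck_empty_diagram diagram_def)
next
  case (Suc n)
  define A where "A = x ` {1..n}"
  define z where "z = x (Suc n)"
  have insert: "x ` {1..Suc n} = insert z A"
    by (simp add: A_def z_def atLeastAtMostSuc_conv)
  have "inj_on x {1..n}"
    using Suc.prems(3) by (rule inj_on_subset) simp
  then have A: "finite A" "card A = n"
    by (simp_all add: A_def card_image)
  have zA: "z \<notin> A"
  proof
    assume "z \<in> A"
    then obtain i where i: "i \<in> {1..n}" "x (Suc n) = x i"
      by (auto simp: A_def z_def)
    have "Suc n = i"
      by (rule inj_onD[OF Suc.prems(3) i(2)]) (use i(1) in auto)
    with i(1) show False by simp
  qed
  have e: "1 + \<beta> * z \<noteq> 0"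
    using Suc.prems(4) by (simp add: z_def)
  let ?e = "1 + \<beta> * z" and ?g = "fpow \<beta> y z (lam ! n)"
  define f where "f = bialternant_row \<beta> y lam"
  define w where "w i b = (\<Prod>j=b+1..lam ! i. oplus \<beta> z (y (n + j - i))) *
        (if lam ! Suc i < b then 1 + \<beta> * oplus \<beta> z (y (n + b - i)) else 1)" for i b
  define F where "F i b a = fpow \<beta> y a (b + (n - Suc i)) * (1 + \<beta> * a) ^ i" for i b a
  define I where "I i a = (\<Sum>b\<in>{lam ! Suc i..lam ! i}. w i b * F i b a)" for i a
  define c where "c i = (\<Prod>p=lam ! Suc i + (n - i)..lam ! i + (n - i). oplus \<beta> z (y p))" for i
  \<comment> \<open>At \<open>a = z\<close> this also shows that the combined rows vanish in the column of \<open>z\<close>.\<close>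
  have elim: "?e * f i a - c i * f (Suc i) a = (a - z) * I i a" if "i < n" for i a
  proof -
    have "lam ! Suc i \<le> lam ! i"
      using partition_nth_mono[OF Suc.prems(1), of i "Suc i"] Suc.prems(2) that by simp
    note row = skew_row_sum[OF that this, of a z \<beta> y]
    have "(a - z) * I i a = ((a - z) *
        (\<Sum>b\<in>{lam ! Suc i..lam ! i}. w i b * fpow \<beta> y a (b + (n - Suc i)))) * (1 + \<beta> * a) ^ i"
      by (simp add: I_def F_def sum_distrib_left sum_distrib_right mult_ac)
    also have "\<dots> = (?e * fpow \<beta> y a (lam ! i + (n - i)) -
        (1 + \<beta> * a) * c i * fpow \<beta> y a (lam ! Suc i + (n - Suc i))) * (1 + \<beta> * a) ^ i"
      unfolding w_def c_def row ..
    also have "\<dots> = ?e * f i a - c i * f (Suc i) a"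
      using Suc.prems(2) by (simp add: f_def bialternant_row_def algebra_simps)
    finally show ?thesis by (rule sym)
  qed
  have "grothendieck lam (Suc n) \<beta> x y =
      ?g * (\<Sum>mu\<in>interlacing lam. (\<Prod>i<n. w i (mu ! i)) * grothendieck mu n \<beta> x y)"
    unfolding w_def z_def by (rule grothendieck_branching[OF Suc.prems(1,2)])
  also have "(\<Sum>mu\<in>interlacing lam. (\<Prod>i<n. w i (mu ! i)) * grothendieck mu n \<beta> x y) =
      (\<Sum>mu\<in>interlacing lam. (\<Prod>i<n. w i (mu ! i)) * bialternant n (\<lambda>i. F i (mu ! i)) A)"
  proof (rule sum.cong[OF refl])
    fix mu assume mu: "mu \<in> interlacing lam"
    then have len: "length mu = n"
      using Suc.prems(2) by (simp add: interlacing_def)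
    have "grothendieck mu n \<beta> x y = bialternant n (bialternant_row \<beta> y mu) A"
      unfolding A_def
      by (rule Suc.IH) (use interlacing_partition[OF mu] len Suc.prems \<open>inj_on x {1..n}\<close> in auto)
    also have "\<dots> = bialternant n (\<lambda>i. F i (mu ! i)) A"
      by (rule bialternant_cong) (simp add: bialternant_row_def F_def len)
    finally show "(\<Prod>i<n. w i (mu ! i)) * grothendieck mu n \<beta> x y =
        (\<Prod>i<n. w i (mu ! i)) * bialternant n (\<lambda>i. F i (mu ! i)) A" by simp
  qed
  also have "interlacing lam =
      {mu. length mu = n \<and> (\<forall>i<n. mu ! i \<in> {lam ! Suc i..lam ! i})}"
    using Suc.prems(2) by (simp add: interlacing_def)
  also have "(\<Sum>mu\<in>\<dots>. (\<Prod>i<n. w i (mu ! i)) * bialternant n (\<lambda>i. F i (mu ! i)) A) =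
      bialternant n I A"
    unfolding I_def by (rule bialternant_multilinear[symmetric]) simp
  finally have G: "grothendieck lam (Suc n) \<beta> x y = ?g * bialternant n I A" .
  let ?N = "\<lambda>i a. if i < n then ?e * f i a - c i * f (Suc i) a else f i a"
  have "?e ^ n * bialternant (Suc n) f (insert z A) = bialternant (Suc n) ?N (insert z A)"
    by (rule bialternant_row_operations[symmetric]) (simp add: A)
  also have "\<dots> = bialternant n ?N A * ?N n z / (\<Prod>a\<in>A. a - z)"
    by (rule bialternant_eliminated_column) (simp_all add: A zA elim)
  also have "bialternant n ?N A = bialternant n (\<lambda>i a. (a - z) * I i a) A"
    by (rule bialternant_cong) (simp add: elim)
  also have "\<dots> = (\<Prod>a\<in>A. a - z) * bialternant n I A"
    by (rule bialternant_scale) (fact A)+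
  also have "?N n z = ?g * ?e ^ n"
    by (simp add: f_def bialternant_row_def Suc.prems(2))
  finally have "?e ^ n * bialternant (Suc n) f (insert z A) = ?e ^ n * (?g * bialternant n I A)"
    using zA A by (auto simp: mult_ac)
  then have "bialternant (Suc n) f (insert z A) = ?g * bialternant n I A"
    using e by (simp del: bialternant.simps)
  then show ?case
    unfolding G insert f_def by (rule sym)
qed

text \<open>Each entry in column \<open>a\<close> contains \<open>fpow \<beta> y a m\<close>. What is left is the quotient for the empty
shape with the shifted parameters \<open>y (m + 1), y (m + 2), \<dots>\<close>, and the bialternant formula
evaluates it to 1.\<close>

lemma bialternant_rectangle:
  fixes y :: "nat \<Rightarrow> 'a::field"
  assumes "finite A" "card A = r" "\<And>a. a \<in> A \<Longrightarrow> 1 + \<beta> * a \<noteq> 0"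
  shows "bialternant r (bialternant_row \<beta> y (replicate r m)) A = (\<Prod>a\<in>A. fpow \<beta> y a m)"
proof -
  obtain h where h: "bij_betw h {1..r} A"
    using ex_bij_betw_nat_finite_1[OF assms(1)] assms(2) by auto
  define y' where "y' = (\<lambda>j. y (m + j))"
  have "bialternant r (bialternant_row \<beta> y (replicate r m)) A =
      bialternant r (\<lambda>i a. fpow \<beta> y a m * bialternant_row \<beta> y' (replicate r 0) i a) A"
  proof (rule bialternant_cong)
    fix i a assume "i < r"
    then show "bialternant_row \<beta> y (replicate r m) i a =
        fpow \<beta> y a m * bialternant_row \<beta> y' (replicate r 0) i a"
      using fpow_add[of \<beta> y a m "r - Suc i"] by (simp add: bialternant_row_def y'_def mult_ac)
  qed
  also have "\<dots> = (\<Prod>a\<in>A. fpow \<beta> y a m) * bialternant r (bialternant_row \<beta> y' (replicate r 0)) A"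
    by (rule bialternant_scale) (fact assms)+
  also have "bialternant r (bialternant_row \<beta> y' (replicate r 0)) A =
      grothendieck (replicate r 0) r \<beta> h y'"
  proof -
    have "is_partition (replicate r 0)"
      by (simp add: is_partition_def sorted_wrt_iff_nth_less)
    moreover have "1 + \<beta> * h i \<noteq> 0" if "i \<in> {1..r}" for i
      using assms(3) bij_betw_apply[OF h that] by simp
    ultimately show ?thesis
      using h by (subst grothendieck_eq_bialternant) (auto simp: bij_betw_def)
  qed
  also have "\<dots> = 1"
    by (rule grothendieck_empty_diagram) (auto simp: diagram_def)
  finally show ?thesis by simp
qed

section \<open>Laplace expansion of Grothendieck polynomials\<close>

lemma subvars_image:
  assumes "finite S" "card S = k"
  shows "subvars x S ` {1..k} = x ` S"
proof -
  have "length (sorted_list_of_set S) = k"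
    using assms by simp
  then have "(\<lambda>t. sorted_list_of_set S ! (t - 1)) ` {1..k} = set (sorted_list_of_set S)"
    by (force simp: set_conv_nth image_iff intro: bexI[of _ "Suc _"])
  also have "\<dots> = S"
    using assms by simp
  finally have "x ` (\<lambda>t. sorted_list_of_set S ! (t - 1)) ` {1..k} = x ` S"
    by (rule arg_cong)
  then show ?thesis
    by (simp add: subvars_def image_image)
qed

text \<open>Row \<open>i < n - k\<close> of the alternant for the long shape is row \<open>i\<close> of the alternant for the rectangle
with \<open>n - k\<close> rows of length \<open>m\<close>; row \<open>n - k + i\<close> is row \<open>i\<close> of the alternant for \<open>lam\<close> times
\<open>(1 + \<beta> * a) ^ (n - k)\<close>.\<close>

lemma grothendieck_laplace:
  fixes x y :: "nat \<Rightarrow> 'a::field"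
  assumes inj: "inj_on x {1..n}" and nz: "\<And>i. i \<in> {1..n} \<Longrightarrow> 1 + \<beta> * x i \<noteq> 0"
    and k: "1 \<le> k" "k \<le> n"
    and lam: "is_partition lam" "length lam = k" and m: "lam ! 0 + k \<le> m"
  shows "grothendieck (replicate (n - k) (m - k) @ lam) n \<beta> x y =
    (\<Sum>S\<in>{S. S \<subseteq> {1..n} \<and> card S = k}.
       grothendieck lam k \<beta> (subvars x S) y *
       (((\<Prod>i\<in>S. (1 + \<beta> * x i) ^ (n - k)) * (\<Prod>j\<in>{1..n} - S. fpow \<beta> y (x j) m)) /
        (\<Prod>i\<in>S. \<Prod>j\<in>{1..n} - S. x j - x i)))"
proof -
  define r where "r = n - k"
  define A where "A = x ` {1..n}"
  define mu where "mu = replicate r (m - k) @ lam"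
  have n: "n = r + k" and len: "length mu = n"
    using k lam by (simp_all add: r_def mu_def)
  have A: "finite A" "card A = r + k"
    using inj n by (simp_all add: A_def card_image)
  have "is_partition mu"
    unfolding is_partition_def mu_def sorted_wrt_append
  proof (intro conjI ballI)
    fix u v assume "u \<in> set (replicate r (m - k))" "v \<in> set lam"
    moreover from this obtain i where "i < k" "v = lam ! i"
      using lam(2) by (auto simp: in_set_conv_nth)
    ultimately show "v \<le> u"
      using partition_nth_mono[OF lam(1), of 0 i] lam(2) m by auto
  qed (use lam(1) in \<open>simp_all add: is_partition_def sorted_wrt_iff_nth_less\<close>)
  then have "grothendieck mu n \<beta> x y = bialternant (r + k) (bialternant_row \<beta> y mu) A"
    using grothendieck_eq_bialternant[OF _ len inj nz] n by (simp add: A_def)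
  also have "\<dots> = (\<Sum>S\<in>{S. S \<subseteq> A \<and> card S = k}. bialternant r (bialternant_row \<beta> y mu) (A - S) *
      bialternant k (\<lambda>i. bialternant_row \<beta> y mu (r + i)) S / (\<Prod>i\<in>S. \<Prod>j\<in>A - S. j - i))"
    by (rule bialternant_laplace) (fact A)+
  also have "{S. S \<subseteq> A \<and> card S = k} = (`) x ` {S. S \<subseteq> {1..n} \<and> card S = k}"
  proof (intro set_eqI iffI)
    fix S assume "S \<in> {S. S \<subseteq> A \<and> card S = k}"
    then obtain S' where "S' \<subseteq> {1..n}" "S = x ` S'" "card (x ` S') = k"
      by (auto simp: A_def subset_image_iff)
    then show "S \<in> (`) x ` {S. S \<subseteq> {1..n} \<and> card S = k}"
      using card_image[OF inj_on_subset[OF inj]] by auto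
  qed (auto simp: A_def card_image[OF inj_on_subset[OF inj]])
  also have "(\<Sum>S\<in>\<dots>. bialternant r (bialternant_row \<beta> y mu) (A - S) *
      bialternant k (\<lambda>i. bialternant_row \<beta> y mu (r + i)) S / (\<Prod>i\<in>S. \<Prod>j\<in>A - S. j - i)) =
    (\<Sum>S\<in>{S. S \<subseteq> {1..n} \<and> card S = k}. bialternant r (bialternant_row \<beta> y mu) (A - x ` S) *
      bialternant k (\<lambda>i. bialternant_row \<beta> y mu (r + i)) (x ` S) /
        (\<Prod>i\<in>x ` S. \<Prod>j\<in>A - x ` S. j - i))"
    by (subst sum.reindex[OF inj_on_subset[OF inj_on_image_Pow[OF inj]]]) auto
  also have "\<dots> = (\<Sum>S\<in>{S. S \<subseteq> {1..n} \<and> card S = k}.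
       grothendieck lam k \<beta> (subvars x S) y *
       (((\<Prod>i\<in>S. (1 + \<beta> * x i) ^ r) * (\<Prod>j\<in>{1..n} - S. fpow \<beta> y (x j) m)) /
        (\<Prod>i\<in>S. \<Prod>j\<in>{1..n} - S. x j - x i)))"
  proof (rule sum.cong[OF refl])
    fix S assume "S \<in> {S. S \<subseteq> {1..n} \<and> card S = k}"
    then have S: "S \<subseteq> {1..n}" "card S = k" "finite S"
      by (auto intro: finite_subset)
    have injS: "inj_on x S" "inj_on x ({1..n} - S)"
      using inj_on_subset[OF inj] S by auto
    have AS: "A - x ` S = x ` ({1..n} - S)"
      unfolding A_def using inj_on_image_set_diff[OF inj, of "{1..n}" S] S by auto
    have "bialternant r (bialternant_row \<beta> y mu) (A - x ` S) =
        bialternant r (bialternant_row \<beta> y (replicate r m)) (A - x ` S)"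
    proof (rule bialternant_cong)
      fix i a assume "i < r"
      then have "mu ! i + (n - Suc i) = m + (r - Suc i)"
        using m n by (simp add: mu_def nth_append)
      then show "bialternant_row \<beta> y mu i a = bialternant_row \<beta> y (replicate r m) i a"
        using \<open>i < r\<close> len by (simp add: bialternant_row_def)
    qed
    also have "\<dots> = (\<Prod>a\<in>A - x ` S. fpow \<beta> y a m)"
    proof (rule bialternant_rectangle)
      show "card (A - x ` S) = r"
        by (subst AS, subst card_image[OF injS(2)], subst card_Diff_subset) (use S n in simp_all)
      show "1 + \<beta> * a \<noteq> 0" if "a \<in> A - x ` S" for a
        using that nz unfolding AS by auto
    qed (use A in simp)
    also have "\<dots> = (\<Prod>j\<in>{1..n} - S. fpow \<beta> y (x j) m)"
      unfolding AS by (subst prod.reindex[OF injS(2)]) simp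
    finally have rect: "bialternant r (bialternant_row \<beta> y mu) (A - x ` S) =
      (\<Prod>j\<in>{1..n} - S. fpow \<beta> y (x j) m)" .
    have "bialternant k (\<lambda>i. bialternant_row \<beta> y mu (r + i)) (x ` S) =
        bialternant k (\<lambda>i a. (1 + \<beta> * a) ^ r * bialternant_row \<beta> y lam i a) (x ` S)"
      by (rule bialternant_cong)
         (simp add: bialternant_row_def len n lam(2) power_add mult_ac, simp add: mu_def nth_append)
    also have "\<dots> = (\<Prod>a\<in>x ` S. (1 + \<beta> * a) ^ r) *
        bialternant k (bialternant_row \<beta> y lam) (x ` S)"
      by (rule bialternant_scale) (simp_all add: S card_image[OF injS(1)])
    also have "(\<Prod>a\<in>x ` S. (1 + \<beta> * a) ^ r) = (\<Prod>i\<in>S. (1 + \<beta> * x i) ^ r)"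
      by (subst prod.reindex[OF injS(1)]) simp
    also have "bialternant k (bialternant_row \<beta> y lam) (x ` S) =
        grothendieck lam k \<beta> (subvars x S) y"
    proof -
      have img: "subvars x S ` {1..k} = x ` S"
        by (rule subvars_image[OF S(3,2)])
      moreover have "inj_on (subvars x S) {1..k}"
        by (rule eq_card_imp_inj_on, simp, subst img) (simp add: card_image[OF injS(1)] S)
      moreover have "1 + \<beta> * subvars x S t \<noteq> 0" if "t \<in> {1..k}" for t
      proof -
        have "subvars x S t \<in> x ` S"
          using that img by blast
        then show ?thesis using nz S(1) by auto
      qed
      ultimately show ?thesis
        using lam by (subst grothendieck_eq_bialternant) simp_all
    qed
    finally have left: "bialternant k (\<lambda>i. bialternant_row \<beta> y mu (r + i)) (x ` S) =
      (\<Prod>i\<in>S. (1 + \<beta> * x i) ^ r) * grothendieck lam k \<beta> (subvars x S) y" .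
    have "(\<Prod>i\<in>x ` S. \<Prod>j\<in>A - x ` S. j - i) = (\<Prod>i\<in>S. \<Prod>j\<in>{1..n} - S. x j - x i)"
      unfolding AS prod.reindex[OF injS(1)] prod.reindex[OF injS(2)] by (simp only: o_def)
    then show "bialternant r (bialternant_row \<beta> y mu) (A - x ` S) *
        bialternant k (\<lambda>i. bialternant_row \<beta> y mu (r + i)) (x ` S) /
        (\<Prod>i\<in>x ` S. \<Prod>j\<in>A - x ` S. j - i) =
       grothendieck lam k \<beta> (subvars x S) y *
       (((\<Prod>i\<in>S. (1 + \<beta> * x i) ^ r) * (\<Prod>j\<in>{1..n} - S. fpow \<beta> y (x j) m)) /
        (\<Prod>i\<in>S. \<Prod>j\<in>{1..n} - S. x j - x i))"
      unfolding rect left by (simp add: mult_ac)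
  qed
  finally show ?thesis unfolding mu_def r_def .
qed

section \<open>Rational functions in the indeterminates\<close>

lemma inj_indet_fun: "inj (indet_fun :: indet \<Rightarrow> 'a::idom ratfun)"
proof (rule injI)
  fix u v assume "(indet_fun u :: 'a ratfun) = indet_fun v"
  then have "Poly_Mapping.single (Poly_Mapping.single u (1::nat)) (1::'a) =
      Poly_Mapping.single (Poly_Mapping.single v 1) 1"
    by (simp add: indet_fun_def eq_fract)
  then have "Poly_Mapping.single u (1::nat) = Poly_Mapping.single v 1"
    by (metis lookup_single_eq lookup_single_not_eq zero_neq_one)
  then show "u = v"
    by (metis lookup_single_eq lookup_single_not_eq zero_neq_one)
qed

lemma one_plus_indet_mult_nonzero: "1 + indet_fun u * indet_fun v \<noteq> (0 :: 'a::idom ratfun)"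
proof
  let ?M = "Poly_Mapping.single u (1::nat) + Poly_Mapping.single v 1"
  assume "1 + indet_fun u * indet_fun v = (0 :: 'a ratfun)"
  then have "1 + Poly_Mapping.single ?M (1::'a) = 0"
    by (simp add: indet_fun_def One_fract_def Zero_fract_def eq_fract mult_single)
  \<comment> \<open>The constant coefficient is 1, because the monomial \<open>u * v\<close> is not constant.\<close>
  then have "Poly_Mapping.lookup (1 + Poly_Mapping.single ?M (1::'a)) 0 = 0"
    by simp
  moreover have "Poly_Mapping.lookup ?M u \<noteq> 0"
    by (simp add: lookup_add)
  then have "?M \<noteq> 0"
    by (metis lookup_zero)
  ultimately show False
    by (simp add: lookup_add lookup_one lookup_single_not_eq)
qed

theorem theorem3p1:
  fixes n k :: nat and m :: int and lam mu :: "nat list"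
    and x y :: "nat \<Rightarrow> 'a::idom ratfun" and \<beta> :: "'a ratfun"
  assumes variables: "x = xvar" "y = yvar" "\<beta> = bvar"
    and "1 \<le> n" and "1 \<le> k" and "k \<le> n"
    and "is_partition lam" and "length lam = k"
    and "int (lam ! 0) \<le> m - int k"
    and mu: "mu = replicate (n - k) (nat (m - int k)) @ lam"
  shows "grothendieck mu n \<beta> x y =
    (\<Sum>S\<in>{S. S \<subseteq> {1..n} \<and> card S = k}.
       grothendieck lam k \<beta> (subvars x S) y *
       (((\<Prod>i\<in>S. (1 + \<beta> * x i) ^ (n - k)) * (\<Prod>j\<in>{1..n} - S. fpow \<beta> y (x j) (nat m))) /
        (\<Prod>i\<in>S. \<Prod>j\<in>{1..n} - S. x j - x i)))"
proof -
  have "inj_on x {1..n}"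
    unfolding variables by (rule inj_onI) (auto simp: xvar_def dest: injD[OF inj_indet_fun])
  moreover have "1 + \<beta> * x i \<noteq> 0" for i
    unfolding variables bvar_def xvar_def by (rule one_plus_indet_mult_nonzero)
  moreover have "lam ! 0 + k \<le> nat m" and "nat (m - int k) = nat m - k"
    using assms(9) by auto
  ultimately show ?thesis
    unfolding mu \<open>nat (m - int k) = nat m - k\<close>
    by (intro grothendieck_laplace assms(5-8))
qed

end
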